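(* For every integer $n\ge 5$, each of the four sequences $(B_{n,k})_{k=0}^{n-1}$, $(C_{n,k})_{k=0}^{n-1}$, $(P_{n,k})_{k=0}^{n-1}$, $(Q_{n,k})_{k=0}^{n-1}$ is ultra-log-concave.
   Context: For a permutation $\pi=\pi_1\pi_2\cdots\pi_n$ of $[n]=\{1,\dots,n\}$, the number of descents is $\mathrm{des}(\pi)=|\{i\in[n-1]:\pi_i>\pi_{i+1}\}|$ and the number of excedances is $\mathrm{exc}(\pi)=|\{i\in[n]:\pi_i>i\}|$. $B_{n,k}$ (resp. $C_{n,k}$) is the number of even (resp. odd) permutations of $[n]$ with exactly $k$ descents; $P_{n,k}$ (resp. $Q_{n,k}$) is the number of even (resp. odd) permutations of $[n]$ with exactly $k$ excedances. A sequence $(a_k)_{k=0}^{m}$ of nonnegative reals is ultra-log-concave if the sequence $\big(a_k/\binom{m}{k}\big)_{k=0}^m$ is log-concave, i.e. $\frac{a_i^2}{\binom{m}{i}^2}\ge\frac{a_{i-1}}{\binom{m}{i-1}}\cdot\frac{a_{i+1}}{\binom{m}{i+1}}$ for all $1\le i\le m-1$. Here it is applied with $m=n-1$. *)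

theory Defs
  imports Complex_Main "HOL-Combinatorics.Permutations"
begin

definition des :: "nat \<Rightarrow> (nat \<Rightarrow> nat) \<Rightarrow> nat" where
  "des n \<pi> = card {i \<in> {1..n - 1}. \<pi> i > \<pi> (i + 1)}"

definition exc :: "nat \<Rightarrow> (nat \<Rightarrow> nat) \<Rightarrow> nat" where
  "exc n \<pi> = card {i \<in> {1..n}. \<pi> i > i}"

definition B_num :: "nat \<Rightarrow> nat \<Rightarrow> nat" where
  "B_num n k = card {\<pi>. \<pi> permutes {1..n} \<and> evenperm \<pi> \<and> des n \<pi> = k}"

definition C_num :: "nat \<Rightarrow> nat \<Rightarrow> nat" where
  "C_num n k = card {\<pi>. \<pi> permutes {1..n} \<and> \<not> evenperm \<pi> \<and> des n \<pi> = k}"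

definition P_num :: "nat \<Rightarrow> nat \<Rightarrow> nat" where
  "P_num n k = card {\<pi>. \<pi> permutes {1..n} \<and> evenperm \<pi> \<and> exc n \<pi> = k}"

definition Q_num :: "nat \<Rightarrow> nat \<Rightarrow> nat" where
  "Q_num n k = card {\<pi>. \<pi> permutes {1..n} \<and> \<not> evenperm \<pi> \<and> exc n \<pi> = k}"

text \<open>A finite sequence indexed by \<open>0, \<dots>, m\<close> is represented by a function on \<^typ>\<open>nat\<close>
  whose values beyond \<open>m\<close> are irrelevant.\<close>

definition log_concave :: "nat \<Rightarrow> (nat \<Rightarrow> real) \<Rightarrow> bool" where
  "log_concave m a \<longleftrightarrow> (\<forall>i \<in> {1..m - 1}. (a i)\<^sup>2 \<ge> a (i - 1) * a (i + 1))"

definition ultra_log_concave :: "nat \<Rightarrow> (nat \<Rightarrow> real) \<Rightarrow> bool" where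
  "ultra_log_concave m a \<longleftrightarrow>
     (\<forall>k \<le> m. a k \<ge> 0) \<and> log_concave m (\<lambda>k. a k / real (m choose k))"

end

theory Submission
  imports Defs "HOL-Computational_Algebra.Polynomial"
begin

text \<open>Let \<open>A\<^sub>n(t)\<close> be the Eulerian polynomial, with coefficients \<open>A(n,k)\<close>. For descents and for
  excedances alike, the generating polynomial of the even (odd) permutations of \<open>{1..n}\<close> is half
  the sum (difference) of \<open>A\<^sub>n(t)\<close> and a polynomial \<open>(1 - t)\<^sup>a A\<^sub>b(t)\<close> with \<open>a + b = n\<close>: here
  \<open>b = 1\<close> for excedances and \<open>b = \<lceil>n/2\<rceil>\<close> for descents. The latter is seen by inserting the two
  largest letters at once: all pairs of insertions cancel except those that make the two letters
  adjacent, and these contribute \<open>1 - t\<close> times the effect of a single unsigned insertion.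

  Even \<open>A(n,k) / (n - 1 choose k)\<^sup>2\<close> is log-concave in \<open>k\<close>, so ultra-log-concavity of the Eulerian
  numbers holds with the factor \<open>((n + 2) / n)\<^sup>2\<close> to spare. For the two values of \<open>b\<close> above and
  \<open>0 < k < n - 1\<close>, the coefficients of \<open>(1 - t)\<^sup>a A\<^sub>b(t)\<close> are at most \<open>A(n,k) / (n + 1)\<close> in absolute
  value, and this factor is what absorbs a perturbation of that size; the two boundary
  inequalities need separate estimates.\<close>

section \<open>Eulerian polynomials\<close>

definition eulerian_op :: "nat \<Rightarrow> real poly \<Rightarrow> real poly" where
  "eulerian_op n p = [:0, 1:] * ([:1, -1:] * pderiv p + of_nat n * p)"

lemma eulerian_op_add: "eulerian_op n (p + q) = eulerian_op n p + eulerian_op n q"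
  by (simp add: eulerian_op_def pderiv_add algebra_simps)

lemma eulerian_op_sum: "eulerian_op n (\<Sum>x\<in>S. f x) = (\<Sum>x\<in>S. eulerian_op n (f x))"
  by (induction S rule: infinite_finite_induct)
    (simp_all add: eulerian_op_add, simp_all add: eulerian_op_def)

lemma eulerian_op_monom:
  "eulerian_op n (monom c d) = monom c d * (of_nat d + (of_nat n - of_nat d) * [:0, 1:])"
proof (cases d)
  case 0
  then show ?thesis by (simp add: eulerian_op_def monom_0 pderiv_pCons)
next
  case (Suc e)
  define X M where "X = [:0, 1 :: real:]" and "M = monom c e"
  have "monom c d = X * M"
    by (simp add: Suc X_def M_def monom_Suc)
  moreover have "pderiv (monom c d) = of_nat d * M"
    by (simp add: Suc M_def pderiv_monom of_nat_poly smult_monom)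
  moreover have "[:1, -1:] = 1 - X"
    by (simp add: X_def one_pCons)
  ultimately have "eulerian_op n (monom c d)
      = X * ((1 - X) * (of_nat d * M) + of_nat n * (X * M))"
    by (simp only: eulerian_op_def X_def)
  also have "\<dots> = X * M * (of_nat d + (of_nat n - of_nat d) * X)"
    by (simp add: algebra_simps)
  finally show ?thesis
    using \<open>monom c d = X * M\<close> by (simp only: X_def)
qed

lemma eulerian_op_power_mult:
  "eulerian_op (a + b) ([:1, -1:] ^ a * p) = [:1, -1:] ^ a * eulerian_op b p"
proof (cases a)
  case (Suc c)
  define y :: "real poly" where "y = [:1, -1:]"
  have "pderiv y = -1"
    by (simp add: y_def pderiv_pCons one_pCons)
  then have "pderiv (y ^ a * p) = y ^ a * pderiv p - of_nat a * y ^ c * p"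
    by (simp only: Suc pderiv_mult pderiv_power_Suc)
      (simp add: of_nat_poly smult_add_left algebra_simps)
  then have "y * pderiv (y ^ a * p) + of_nat (a + b) * (y ^ a * p)
      = y * (y ^ a * pderiv p - of_nat a * y ^ c * p) + of_nat (a + b) * (y ^ a * p)"
    by (simp only:)
  also have "\<dots> = y ^ a * (y * pderiv p + of_nat b * p)"
    by (simp add: Suc algebra_simps)
  finally show ?thesis
    by (simp only: eulerian_op_def mult.left_commute flip: y_def)
qed simp

lemma coeff_add_eulerian_op:
  "coeff (p + eulerian_op n p) 0 = coeff p 0"
  "coeff (p + eulerian_op n p) (Suc k)
      = (real k + 2) * coeff p (Suc k) + (real n - real k) * coeff p k"
proof -
  have expand: "p + eulerian_op n p
      = p + pCons 0 (pderiv p - pCons 0 (pderiv p) + smult (real n) p)"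
    by (simp add: eulerian_op_def of_nat_poly algebra_simps)
  have "coeff (pCons 0 (pderiv p)) k = real k * coeff p k"
    by (cases k) (simp_all add: coeff_pderiv)
  then show "coeff (p + eulerian_op n p) 0 = coeff p 0"
    "coeff (p + eulerian_op n p) (Suc k)
      = (real k + 2) * coeff p (Suc k) + (real n - real k) * coeff p k"
    by (simp_all add: expand coeff_pderiv algebra_simps)
qed

primrec eulerian_poly :: "nat \<Rightarrow> real poly" where
  "eulerian_poly 0 = 1"
| "eulerian_poly (Suc n) = eulerian_poly n + eulerian_op n (eulerian_poly n)"

definition eulerian :: "nat \<Rightarrow> nat \<Rightarrow> real" where
  "eulerian n k = coeff (eulerian_poly n) k"

lemma eulerian_0_left: "eulerian 0 k = of_bool (k = 0)"
  by (simp add: eulerian_def)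

lemma eulerian_Suc_Suc:
  "eulerian (Suc n) (Suc k)
    = (real k + 2) * eulerian n (Suc k) + (real n - real k) * eulerian n k"
  by (simp add: eulerian_def coeff_add_eulerian_op del: coeff_add)

lemma eulerian_0_right [simp]: "eulerian n 0 = 1"
  by (induction n) (simp_all add: eulerian_def coeff_add_eulerian_op del: coeff_add)

lemma eulerian_1_right: "eulerian n 1 = 2 ^ n - real n - 1"
  by (induction n) (simp_all add: eulerian_0_left eulerian_Suc_Suc algebra_simps)

lemma eulerian_eq_0: "n \<le> k \<Longrightarrow> 0 < k \<Longrightarrow> eulerian n k = 0"
proof (induction n arbitrary: k)
  case (Suc n)
  then obtain j where "k = Suc j" by (cases k) auto
  with Suc show ?case by (cases "j = n") (auto simp: eulerian_Suc_Suc)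
qed (simp add: eulerian_0_left)

lemma eulerian_pos: "k < n \<Longrightarrow> 0 < eulerian n k"
proof (induction n arbitrary: k)
  case (Suc n)
  show ?case
  proof (cases k)
    case (Suc j)
    have "0 \<le> eulerian n (Suc j)"
      using Suc.IH[of "Suc j"] eulerian_eq_0[of n "Suc j"] by (cases "Suc j < n") auto
    moreover have "0 < eulerian n j" "0 < real n - real j"
      using Suc.IH[of j] Suc.prems Suc by auto
    ultimately show ?thesis
      by (simp add: Suc eulerian_Suc_Suc add_nonneg_pos)
  qed simp
qed simp

lemma eulerian_nonneg: "0 \<le> eulerian n k"
  using eulerian_pos[of k n] eulerian_eq_0[of n k] by (cases "k < n"; cases "k = 0") auto

lemma eulerian_symmetric: "Suc (j + k) = n \<Longrightarrow> eulerian n j = eulerian n k"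
proof (induction n arbitrary: j k)
  case (Suc n)
  have top: "eulerian (Suc n) n = 1"
    using Suc.IH[of "n - 1" 0] eulerian_eq_0[of n n]
    by (cases n) (auto simp: eulerian_Suc_Suc)
  consider (first) "j = 0" | (last) "k = 0" | (interior) i l where "j = Suc i" "k = Suc l"
    by (cases j; cases k) auto
  then show ?case
  proof cases
    case interior
    then have "eulerian n (Suc i) = eulerian n l" "eulerian n i = eulerian n (Suc l)"
      using Suc.prems by (intro Suc.IH; simp)+
    moreover have "real n = real i + real l + 2"
      using Suc.prems interior by simp
    ultimately show ?thesis
      by (simp add: interior eulerian_Suc_Suc algebra_simps)
  qed (use Suc.prems top in auto)
qed simp

lemma degree_eulerian_poly: "degree (eulerian_poly (Suc n)) = n"
proof (rule antisym)
  show "degree (eulerian_poly (Suc n)) \<le> n"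
    using eulerian_eq_0[of "Suc n"] by (intro degree_le) (auto simp: eulerian_def)
  show "n \<le> degree (eulerian_poly (Suc n))"
    using eulerian_pos[of n "Suc n"] by (intro le_degree) (auto simp: eulerian_def)
qed

lemma reflect_eulerian_poly: "reflect_poly (eulerian_poly (Suc n)) = eulerian_poly (Suc n)"
proof (rule poly_eqI)
  fix k
  show "coeff (reflect_poly (eulerian_poly (Suc n))) k = coeff (eulerian_poly (Suc n)) k"
    using eulerian_symmetric[of "n - k" k "Suc n"] eulerian_eq_0[of "Suc n" k]
    by (auto simp: coeff_reflect_poly degree_eulerian_poly eulerian_def
        simp del: eulerian_poly.simps)
qed

lemma eulerian_Suc_Suc_ge:
  assumes "Suc (Suc k) \<le> n"
  shows "2 * (eulerian n (Suc k) + eulerian n k) \<le> eulerian (Suc n) (Suc k)"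
proof -
  have "2 * eulerian n (Suc k) + 2 * eulerian n k
      \<le> (real k + 2) * eulerian n (Suc k) + (real n - real k) * eulerian n k"
    using assms by (intro add_mono mult_right_mono eulerian_nonneg) auto
  then show ?thesis by (simp add: eulerian_Suc_Suc)
qed

section \<open>Differences of Eulerian numbers\<close>

text \<open>The \<open>a\<close>-th backward difference of \<open>A(b,k)\<close> with respect to \<open>k\<close>.\<close>

definition eulerian_diff :: "nat \<Rightarrow> nat \<Rightarrow> nat \<Rightarrow> real" where
  "eulerian_diff a b k = coeff ([:1, -1:] ^ a * eulerian_poly b) k"

lemma eulerian_diff_order_0: "eulerian_diff 0 b k = eulerian b k"
  by (simp add: eulerian_diff_def eulerian_def)

lemma eulerian_diff_coeff_0: "eulerian_diff a b 0 = 1"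
  using eulerian_0_right[of b]
  by (simp add: eulerian_diff_def eulerian_def coeff_mult_0 coeff_0_power)

lemma eulerian_diff_Suc_order:
  "eulerian_diff (Suc a) b (Suc k) = eulerian_diff a b (Suc k) - eulerian_diff a b k"
proof -
  have "[:1, -1:] ^ Suc a * eulerian_poly b
      = [:1, -1:] ^ a * eulerian_poly b - pCons 0 ([:1, -1:] ^ a * eulerian_poly b)"
    unfolding power_Suc mult.assoc by simp
  then show ?thesis
    by (simp only: eulerian_diff_def coeff_diff coeff_pCons_Suc)
qed

lemma eulerian_diff_Suc_row:
  "eulerian_diff a (Suc b) (Suc k)
    = (real k + 2) * eulerian_diff a b (Suc k) + (real (a + b) - real k) * eulerian_diff a b k"
proof -
  have "[:1, -1:] ^ a * eulerian_poly (Suc b)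
      = [:1, -1:] ^ a * eulerian_poly b + eulerian_op (a + b) ([:1, -1:] ^ a * eulerian_poly b)"
    by (simp only: eulerian_op_power_mult eulerian_poly.simps distrib_left)
  then show ?thesis
    by (simp only: eulerian_diff_def coeff_add_eulerian_op)
qed

lemma eulerian_diff_coeff_1: "eulerian_diff a b 1 = 2 ^ b - real (a + b) - 1"
  using eulerian_1_right[of b]
  by (induction a)
    (simp_all add: eulerian_diff_order_0 eulerian_diff_Suc_order eulerian_diff_coeff_0)

lemma eulerian_diff_symmetric:
  assumes "0 < b" "Suc (j + k) = a + b"
  shows "eulerian_diff a b j = (-1) ^ a * eulerian_diff a b k"
proof -
  define p where "p = [:1, -1:] ^ a * eulerian_poly b"
  obtain c where b: "b = Suc c" using assms(1) by (cases b) auto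
  then have "eulerian_poly b \<noteq> 0"
    using degree_eulerian_poly eulerian_0_right[of b] by (metis coeff_0 eulerian_def zero_neq_one)
  then have degree: "degree p = j + k"
    using assms(2) degree_eulerian_poly[of c]
    by (simp add: p_def b degree_mult_eq degree_power_eq del: eulerian_poly.simps)
  have "reflect_poly p = [:-1, 1:] ^ a * eulerian_poly b"
    by (simp add: p_def b reflect_poly_mult reflect_poly_power reflect_eulerian_poly
        reflect_poly_pCons del: eulerian_poly.simps)
  also have "[:-1, 1:] = smult (-1) [:1, -1 :: real:]" by simp
  also have "smult (-1) [:1, -1 :: real:] ^ a * eulerian_poly b = smult ((-1) ^ a) p"
    by (simp only: p_def smult_power mult_smult_left)
  finally have "coeff (reflect_poly p) j = (-1) ^ a * coeff p j" by simp
  then have "coeff p k = (-1) ^ a * coeff p j"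
    by (simp add: coeff_reflect_poly degree)
  then show ?thesis
    by (simp add: eulerian_diff_def p_def flip: power_mult_distrib mult.assoc)
qed

section \<open>Log-concave sequences\<close>

lemma log_concave_iff:
  "log_concave m a \<longleftrightarrow> (\<forall>k. Suc (Suc k) \<le> m \<longrightarrow> a k * a (Suc (Suc k)) \<le> (a (Suc k))\<^sup>2)"
proof -
  have "{1..m - 1} = Suc ` {k. Suc (Suc k) \<le> m}"
    by (auto simp: image_iff Suc_le_eq gr0_conv_Suc)
  then show ?thesis by (simp add: log_concave_def)
qed

lemma log_concave_cong:
  "(\<And>k. k \<le> m \<Longrightarrow> a k = b k) \<Longrightarrow> log_concave m a \<longleftrightarrow> log_concave m b"
  by (simp add: log_concave_iff)

lemma log_concave_scale:
  assumes "log_concave m a"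
  shows "log_concave m (\<lambda>k. c * a k)"
proof -
  have "c\<^sup>2 * (a k * a (Suc (Suc k))) \<le> c\<^sup>2 * (a (Suc k))\<^sup>2" if "Suc (Suc k) \<le> m" for k
    using assms that by (intro mult_left_mono) (auto simp: log_concave_iff)
  then show ?thesis
    by (auto simp: log_concave_iff power2_eq_square algebra_simps)
qed

lemma log_concave_two_term_step:
  fixes x0 x1 x2 x3 :: real
  assumes x_signs: "0 \<le> x0" "0 < x1" "0 < x2" "0 \<le> x3"
    and x_log_concave: "x0 * x2 \<le> x1\<^sup>2" "x1 * x3 \<le> x2\<^sup>2"
    and weights_nonneg: "0 \<le> f1" "0 \<le> f3" "0 \<le> g1" "0 \<le> g3"
    and f_gap: "f1 * f3 + \<alpha>\<^sup>2 \<le> f2\<^sup>2"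
    and g_gap: "g1 * g3 + \<beta>\<^sup>2 \<le> g2\<^sup>2"
    and cross: "f1 * g3 + g1 * f3 \<le> 2 * (f2 * g2 + \<alpha> * \<beta>)"
  shows "(f1 * x1 + g1 * x0) * (f3 * x3 + g3 * x2) \<le> (f2 * x2 + g2 * x1)\<^sup>2"
proof -
  have outer: "x0 * x3 \<le> x1 * x2"
  proof -
    have "(x0 * x2) * (x1 * x3) \<le> x1\<^sup>2 * x2\<^sup>2"
      using x_log_concave x_signs by (intro mult_mono) auto
    then have "(x0 * x3) * (x1 * x2) \<le> (x1 * x2) * (x1 * x2)"
      by (simp add: power2_eq_square algebra_simps)
    then show ?thesis
      using x_signs by (simp add: mult_le_cancel_right)
  qed
  have "(f1 * x1 + g1 * x0) * (f3 * x3 + g3 * x2)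
      = (f1 * f3) * (x1 * x3) + (g1 * g3) * (x0 * x2)
        + (g1 * f3) * (x0 * x3) + (f1 * g3) * (x1 * x2)"
    by (simp add: algebra_simps)
  also have "\<dots> \<le> (f1 * f3) * x2\<^sup>2 + (g1 * g3) * x1\<^sup>2
        + (g1 * f3) * (x1 * x2) + (f1 * g3) * (x1 * x2)"
    using x_log_concave outer weights_nonneg x_signs
    by (intro add_mono mult_left_mono) auto
  also have "\<dots> = (f1 * f3) * x2\<^sup>2 + (g1 * g3) * x1\<^sup>2 + (f1 * g3 + g1 * f3) * (x1 * x2)"
    by (simp add: algebra_simps)
  also have "\<dots> \<le> (f2\<^sup>2 - \<alpha>\<^sup>2) * x2\<^sup>2 + (g2\<^sup>2 - \<beta>\<^sup>2) * x1\<^sup>2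
        + (2 * (f2 * g2 + \<alpha> * \<beta>)) * (x1 * x2)"
    using f_gap g_gap cross x_signs by (intro add_mono mult_right_mono) auto
  also have "\<dots> = (f2 * x2 + g2 * x1)\<^sup>2 - (\<alpha> * x2 - \<beta> * x1)\<^sup>2"
    by (simp add: power2_eq_square algebra_simps)
  also have "\<dots> \<le> (f2 * x2 + g2 * x1)\<^sup>2" by simp
  finally show ?thesis .
qed

lemma log_concave_triangular_recurrence:
  fixes x f g \<alpha> \<beta> :: "nat \<Rightarrow> real"
  assumes x_log_concave: "log_concave m x" and x_pos: "\<And>k. k \<le> m \<Longrightarrow> 0 < x k"
    and weights_nonneg: "\<And>k. k \<le> Suc m \<Longrightarrow> 0 \<le> f k" "\<And>k. k \<le> Suc m \<Longrightarrow> 0 \<le> g k"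
    and f_end: "f (Suc m) = 0" and g_start: "g 0 = 0"
    and f_gap: "\<And>k. k < m \<Longrightarrow> f k * f (Suc (Suc k)) + (\<alpha> (Suc k))\<^sup>2 \<le> (f (Suc k))\<^sup>2"
    and g_gap: "\<And>k. k < m \<Longrightarrow> g k * g (Suc (Suc k)) + (\<beta> (Suc k))\<^sup>2 \<le> (g (Suc k))\<^sup>2"
    and cross: "\<And>k. k < m \<Longrightarrow> f k * g (Suc (Suc k)) + g k * f (Suc (Suc k))
                  \<le> 2 * (f (Suc k) * g (Suc k) + \<alpha> (Suc k) * \<beta> (Suc k))"
  shows "log_concave (Suc m) (\<lambda>k. f k * x k + g k * x (k - 1))"
  unfolding log_concave_iff
proof (intro allI impI)
  fix k assume "Suc (Suc k) \<le> Suc m"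
  then have k_less: "k < m" by simp
  define x0 x3 where "x0 = (if k = 0 then 0 else x (k - 1))"
    and "x3 = (if Suc (Suc k) \<le> m then x (Suc (Suc k)) else 0)"
  have "x0 * x (Suc k) \<le> (x k)\<^sup>2" "x k * x3 \<le> (x (Suc k))\<^sup>2"
    using x_log_concave k_less by (cases k; auto simp: log_concave_iff x0_def x3_def)+
  moreover have "0 \<le> x0" "0 \<le> x3" "0 < x k" "0 < x (Suc k)"
    using x_pos k_less by (auto simp: x0_def x3_def less_imp_le)
  ultimately have "(f k * x k + g k * x0) * (f (Suc (Suc k)) * x3 + g (Suc (Suc k)) * x (Suc k))
      \<le> (f (Suc k) * x (Suc k) + g (Suc k) * x k)\<^sup>2"
    using k_less
    by (intro log_concave_two_term_step[OF _ _ _ _ _ _ _ _ _ _ f_gap g_gap cross] weights_nonneg)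
      auto
  moreover have "g k * x (k - 1) = g k * x0"
    using g_start by (simp add: x0_def)
  moreover have "f (Suc (Suc k)) * x (Suc (Suc k)) = f (Suc (Suc k)) * x3"
    using f_end k_less by (cases "Suc k = m") (auto simp: x3_def)
  ultimately show "(f k * x k + g k * x (k - 1))
      * (f (Suc (Suc k)) * x (Suc (Suc k)) + g (Suc (Suc k)) * x (Suc (Suc k) - 1))
      \<le> (f (Suc k) * x (Suc k) + g (Suc k) * x (Suc k - 1))\<^sup>2"
    by (simp only: diff_Suc_1)
qed

lemma log_concave_step_perturb:
  fixes \<delta> p q r :: real
  assumes "0 \<le> \<delta>" "\<delta> \<le> 1" "0 \<le> p" "0 \<le> q" "0 \<le> r"
    and gap: "(1 + \<delta>)\<^sup>2 * (p * r) \<le> (1 - \<delta>)\<^sup>2 * q\<^sup>2"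
    and small: "\<bar>p'\<bar> \<le> \<delta> * p" "\<bar>q'\<bar> \<le> \<delta> * q" "\<bar>r'\<bar> \<le> \<delta> * r"
  shows "(p + p') * (r + r') \<le> (q + q')\<^sup>2"
proof -
  have "\<delta> * q \<le> 1 * q" "\<delta> * r \<le> 1 * r"
    using assms by (intro mult_right_mono; simp)+
  then have "(p + p') * (r + r') \<le> ((1 + \<delta>) * p) * ((1 + \<delta>) * r)"
    using assms by (intro mult_mono) (auto simp: algebra_simps)
  also have "\<dots> = (1 + \<delta>)\<^sup>2 * (p * r)"
    by (simp add: power2_eq_square)
  also note gap
  also have "(1 - \<delta>)\<^sup>2 * q\<^sup>2 = ((1 - \<delta>) * q)\<^sup>2"
    by (simp add: power_mult_distrib)
  also have "\<dots> \<le> (q + q')\<^sup>2"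
    using assms \<open>\<delta> * q \<le> 1 * q\<close> by (intro power_mono) (auto simp: algebra_simps)
  finally show ?thesis .
qed

lemma log_concave_perturb_symmetric:
  fixes a d :: "nat \<Rightarrow> real"
  assumes \<delta>_bounds: "0 \<le> \<delta>" "\<delta> \<le> 1"
    and signs: "\<sigma> \<in> {1, -1}" "\<tau> \<in> {1, -1}"
    and a_nonneg: "\<And>k. 0 \<le> a k" and a_sym: "\<And>j k. j + k = m \<Longrightarrow> a j = a k"
    and d_0: "d 0 = a 0" and d_sym: "\<And>j k. j + k = m \<Longrightarrow> d j = \<tau> * d k"
    and small: "\<And>k. 0 < k \<Longrightarrow> k < m \<Longrightarrow> \<bar>d k\<bar> \<le> \<delta> * a k"
    and gap: "\<And>k. Suc (Suc k) \<le> m \<Longrightarrow>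
      (1 + \<delta>)\<^sup>2 * (a k * a (Suc (Suc k))) \<le> (1 - \<delta>)\<^sup>2 * (a (Suc k))\<^sup>2"
    and edge: "(a 0 + d 0) * (a 2 + d 2) \<le> (a 1 + d 1)\<^sup>2"
  shows "log_concave m (\<lambda>k. a k + \<sigma> * d k)"
  unfolding log_concave_iff
proof (intro allI impI)
  fix k assume "Suc (Suc k) \<le> m"
  have signed_edge: "(a 0 + s * d 0) * (a 2 + s * d 2) \<le> (a 1 + s * d 1)\<^sup>2"
    if "s \<in> {1, -1}" for s
    using that edge d_0 by auto
  consider (left) "k = 0" | (right) "Suc (Suc k) = m" | (interior) "0 < k" "Suc (Suc k) < m"
    using \<open>Suc (Suc k) \<le> m\<close> by linarith
  then show "(a k + \<sigma> * d k) * (a (Suc (Suc k)) + \<sigma> * d (Suc (Suc k)))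
      \<le> (a (Suc k) + \<sigma> * d (Suc k))\<^sup>2"
  proof cases
    case left
    then show ?thesis using signed_edge[OF signs(1)] by (simp add: numeral_2_eq_2)
  next
    case right
    have "a k = a 2" "a (Suc k) = a 1" "a (Suc (Suc k)) = a 0"
      by (rule a_sym, use right in simp)+
    moreover have "d k = \<tau> * d 2" "d (Suc k) = \<tau> * d 1" "d (Suc (Suc k)) = \<tau> * d 0"
      by (rule d_sym, use right in simp)+
    moreover have "\<sigma> * \<tau> \<in> {1, -1}" using signs by auto
    note signed_edge[OF this]
    ultimately show ?thesis by (simp add: mult_ac)
  next
    case interior
    have "\<bar>\<sigma> * d i\<bar> \<le> \<delta> * a i" if "0 < i" "i < m" for i
      using small[OF that] signs(1) by auto
    then show ?thesis
      using interior \<delta>_bounds by (intro log_concave_step_perturb[OF _ _ _ _ _ gap] a_nonneg) auto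
  qed
qed

section \<open>A log-concavity gap for the Eulerian numbers\<close>

definition eulerian_norm :: "nat \<Rightarrow> nat \<Rightarrow> real" where
  "eulerian_norm n k = eulerian n k / (real (n - 1 choose k))\<^sup>2"

lemma eulerian_norm_0_right: "eulerian_norm n 0 = 1"
  by (simp add: eulerian_norm_def)

lemma eulerian_norm_pos: "k < n \<Longrightarrow> 0 < eulerian_norm n k"
  by (simp add: eulerian_norm_def eulerian_pos)

lemma eulerian_eq_norm_mult:
  "0 < n \<Longrightarrow> eulerian n k = eulerian_norm n k * (real (n - 1 choose k))\<^sup>2"
  using eulerian_eq_0[of n k] by (cases "k < n") (auto simp: eulerian_norm_def)

lemma eulerian_norm_Suc:
  assumes "0 < n" and k_le: "k \<le> n"
  shows "(real n)\<^sup>2 * eulerian_norm (Suc n) k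
      = (real k + 1) * (real n - real k)\<^sup>2 * eulerian_norm n k
        + (real n + 1 - real k) * (real k)\<^sup>2 * eulerian_norm n (k - 1)"
proof (cases k)
  case 0
  then show ?thesis by (simp add: eulerian_norm_0_right)
next
  case (Suc j)
  define c where "c = real (n choose k)"
  have "0 < c" using k_le by (simp add: c_def)
  have "real (n * (n - 1 choose k)) = real ((n - k) * (n choose k))"
    "real (n * (n - 1 choose j)) = real (k * (n choose k))"
    using binomial_absorb_comp[of n k] times_binomial_minus1_eq[of k n] Suc by simp_all
  then have shifts: "real n * real (n - 1 choose k) = (real n - real k) * c"
    "real n * real (n - 1 choose j) = real k * c"
    using k_le by (simp_all add: c_def)
  have "(real n)\<^sup>2 * eulerian n k = eulerian_norm n k * (real n * real (n - 1 choose k))\<^sup>2"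
    "(real n)\<^sup>2 * eulerian n j = eulerian_norm n j * (real n * real (n - 1 choose j))\<^sup>2"
    using \<open>0 < n\<close> by (simp_all add: eulerian_eq_norm_mult power_mult_distrib)
  then have scaled: "(real n)\<^sup>2 * eulerian n k = eulerian_norm n k * ((real n - real k) * c)\<^sup>2"
    "(real n)\<^sup>2 * eulerian n j = eulerian_norm n j * (real k * c)\<^sup>2"
    unfolding shifts .
  have "(real n)\<^sup>2 * eulerian_norm (Suc n) k * c\<^sup>2 = (real n)\<^sup>2 * eulerian (Suc n) k"
    using \<open>0 < c\<close> by (simp add: eulerian_norm_def c_def)
  also have "\<dots> = (real k + 1) * ((real n)\<^sup>2 * eulerian n k)
      + (real n + 1 - real k) * ((real n)\<^sup>2 * eulerian n j)"
    by (simp add: Suc eulerian_Suc_Suc algebra_simps)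
  also have "\<dots> = ((real k + 1) * (real n - real k)\<^sup>2 * eulerian_norm n k
      + (real n + 1 - real k) * (real k)\<^sup>2 * eulerian_norm n j) * c\<^sup>2"
    unfolding scaled by algebra
  finally show ?thesis using \<open>0 < c\<close> Suc by simp
qed

lemma eulerian_weight_log_concave:
  fixes a b :: real
  assumes "1 \<le> b"
  shows "(a * (b + 1)\<^sup>2) * ((a + 2) * (b - 1)\<^sup>2) + ((a + 1) * b)\<^sup>2 \<le> ((a + 1) * b\<^sup>2)\<^sup>2"
proof -
  have "((a + 1) * b\<^sup>2)\<^sup>2 - (a * (b + 1)\<^sup>2) * ((a + 2) * (b - 1)\<^sup>2) - ((a + 1) * b)\<^sup>2
      = (b\<^sup>2 - 1) * ((a + 1)\<^sup>2 + (b\<^sup>2 - 1))"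
    by algebra
  also have "\<dots> \<ge> 0"
    using assms by (intro mult_nonneg_nonneg add_nonneg_nonneg) auto
  finally show ?thesis by simp
qed

lemma eulerian_weight_cross:
  fixes a b :: real
  assumes "1 \<le> a" "1 \<le> b"
  shows "(a * (b + 1)\<^sup>2) * (b * (a + 1)\<^sup>2) + ((b + 2) * (a - 1)\<^sup>2) * ((a + 2) * (b - 1)\<^sup>2)
    \<le> 2 * (((a + 1) * b\<^sup>2) * ((b + 1) * a\<^sup>2) + ((a + 1) * b) * ((b + 1) * a))"
proof -
  define u v where "u = a - 1" and "v = b - 1"
  have "2 * (((a + 1) * b\<^sup>2) * ((b + 1) * a\<^sup>2) + ((a + 1) * b) * ((b + 1) * a))
      - (a * (b + 1)\<^sup>2) * (b * (a + 1)\<^sup>2) - ((b + 2) * (a - 1)\<^sup>2) * ((a + 2) * (b - 1)\<^sup>2)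
      = 2 * (u * v) * (2 + 3 * u + 3 * v + u\<^sup>2 + v\<^sup>2)"
    unfolding u_def v_def by algebra
  also have "\<dots> \<ge> 0"
    using assms by (intro mult_nonneg_nonneg add_nonneg_nonneg) (auto simp: u_def v_def)
  finally show ?thesis by simp
qed

lemma log_concave_eulerian_norm_Suc:
  assumes "log_concave (n - 1) (eulerian_norm n)" and "0 < n"
  shows "log_concave n (eulerian_norm (Suc n))"
proof -
  obtain m where n: "n = Suc m" using assms(2) by (cases n) auto
  define f g :: "nat \<Rightarrow> real" where "f k = (real k + 1) * (real n - real k)\<^sup>2"
    and "g k = (real n + 1 - real k) * (real k)\<^sup>2" for k
  define \<alpha> \<beta> :: "nat \<Rightarrow> real" where "\<alpha> k = (real k + 1) * (real n - real k)"
    and "\<beta> k = (real n + 1 - real k) * real k" for k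
  have "log_concave (Suc m) (\<lambda>k. f k * eulerian_norm n k + g k * eulerian_norm n (k - 1))"
  proof (rule log_concave_triangular_recurrence[where \<alpha> = \<alpha> and \<beta> = \<beta>])
    show "log_concave m (eulerian_norm n)"
      using assms(1) by (simp add: n)
    fix k assume "k < m"
    define a b where "a = real (Suc k)" and "b = real n - a"
    have ge_1: "1 \<le> a" "1 \<le> b"
      using \<open>k < m\<close> by (auto simp: n a_def b_def)
    have weights: "f k = a * (b + 1)\<^sup>2" "f (Suc k) = (a + 1) * b\<^sup>2"
      "f (Suc (Suc k)) = (a + 2) * (b - 1)\<^sup>2"
      "g k = (b + 2) * (a - 1)\<^sup>2" "g (Suc k) = (b + 1) * a\<^sup>2"
      "g (Suc (Suc k)) = b * (a + 1)\<^sup>2"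
      "\<alpha> (Suc k) = (a + 1) * b" "\<beta> (Suc k) = (b + 1) * a"
      by (simp_all add: f_def g_def \<alpha>_def \<beta>_def a_def b_def algebra_simps)
    show "f k * f (Suc (Suc k)) + (\<alpha> (Suc k))\<^sup>2 \<le> (f (Suc k))\<^sup>2"
      unfolding weights by (rule eulerian_weight_log_concave[OF ge_1(2)])
    show "g k * g (Suc (Suc k)) + (\<beta> (Suc k))\<^sup>2 \<le> (g (Suc k))\<^sup>2"
      using eulerian_weight_log_concave[OF ge_1(1), of b] unfolding weights
      by (simp only: mult.commute)
    show "f k * g (Suc (Suc k)) + g k * f (Suc (Suc k))
        \<le> 2 * (f (Suc k) * g (Suc k) + \<alpha> (Suc k) * \<beta> (Suc k))"
      unfolding weights by (rule eulerian_weight_cross[OF ge_1])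
  qed (auto simp: n f_def g_def eulerian_norm_pos)
  then have "log_concave n (\<lambda>k. 1 / (real n)\<^sup>2
      * (f k * eulerian_norm n k + g k * eulerian_norm n (k - 1)))"
    unfolding n by (rule log_concave_scale)
  moreover have "1 / (real n)\<^sup>2 * (f k * eulerian_norm n k + g k * eulerian_norm n (k - 1))
      = eulerian_norm (Suc n) k" if "k \<le> n" for k
    using eulerian_norm_Suc[OF assms(2) that] assms(2) by (simp add: f_def g_def field_simps)
  ultimately show ?thesis
    by (rule log_concave_cong[THEN iffD1, rotated])
qed

lemma log_concave_eulerian_norm: "log_concave (n - 1) (eulerian_norm n)"
proof (induction n)
  case (Suc n)
  then show ?case
    by (cases "n = 0") (simp_all add: log_concave_eulerian_norm_Suc, simp add: log_concave_iff)
qed (simp add: log_concave_iff)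

lemma binomial_log_concavity_defect:
  assumes "Suc k < n"
  shows "(real k + 2) * (real n - real k) * (real (n choose k) * real (n choose Suc (Suc k)))
       = (real k + 1) * (real n - real k - 1) * (real (n choose Suc k))\<^sup>2"
proof -
  have absorb: "(real i + 1) * real (n choose Suc i) = (real n - real i) * real (n choose i)"
    if "i \<le> n" for i
  proof -
    have "real (Suc i * (n choose Suc i)) = real ((n - i) * (n choose i))"
      by (metis binomial_absorption binomial_absorb_comp)
    then show ?thesis using that by (simp add: algebra_simps)
  qed
  have "(real k + 2) * (real n - real k) * (real (n choose k) * real (n choose Suc (Suc k)))
     = ((real n - real k) * real (n choose k))
       * ((real (Suc k) + 1) * real (n choose Suc (Suc k)))"
    by (simp add: mult_ac)
  also have "\<dots> = ((real k + 1) * real (n choose Suc k))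
      * ((real n - real (Suc k)) * real (n choose Suc k))"
    using assms by (simp only: absorb less_imp_le Suc_lessD)
  also have "\<dots> = (real k + 1) * (real n - real k - 1) * (real (n choose Suc k))\<^sup>2"
    by (simp add: power2_eq_square algebra_simps)
  finally show ?thesis .
qed

definition eulerian_ratio :: "nat \<Rightarrow> nat \<Rightarrow> real" where
  "eulerian_ratio n k = eulerian n k / real (n - 1 choose k)"

lemma eulerian_ratio_nonneg: "0 \<le> eulerian_ratio n k"
  by (simp add: eulerian_ratio_def eulerian_nonneg)

lemma eulerian_ratio_0_right: "eulerian_ratio n 0 = 1"
  by (simp add: eulerian_ratio_def)

lemma eulerian_ratio_symmetric:
  "Suc (j + k) = n \<Longrightarrow> eulerian_ratio n j = eulerian_ratio n k"
  using eulerian_symmetric[of j k n] binomial_symmetric[of j "n - 1"]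
  by (auto simp: eulerian_ratio_def)

lemma eulerian_ratio_gap:
  assumes "Suc (Suc k) < n"
  shows "(real k + 2) * (real n - 1 - real k)
         * (eulerian_ratio n k * eulerian_ratio n (Suc (Suc k)))
       \<le> (real k + 1) * (real n - 2 - real k) * (eulerian_ratio n (Suc k))\<^sup>2"
proof -
  define c where "c i = real (n - 1 choose i)" for i
  have ratio_eq_norm: "eulerian_ratio n i = eulerian_norm n i * c i" for i
    by (simp add: eulerian_ratio_def eulerian_norm_def c_def power2_eq_square)
  have defect: "(real k + 2) * (real n - 1 - real k) * (c k * c (Suc (Suc k)))
      = (real k + 1) * (real n - 2 - real k) * (c (Suc k))\<^sup>2"
    using binomial_log_concavity_defect[of k "n - 1"] assms
    by (simp add: c_def algebra_simps)
  have "(real k + 2) * (real n - 1 - real k)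
        * (eulerian_ratio n k * eulerian_ratio n (Suc (Suc k)))
      = ((real k + 1) * (real n - 2 - real k) * (c (Suc k))\<^sup>2)
         * (eulerian_norm n k * eulerian_norm n (Suc (Suc k)))"
    by (simp add: ratio_eq_norm flip: defect)
  also have "\<dots> \<le> ((real k + 1) * (real n - 2 - real k) * (c (Suc k))\<^sup>2)
      * (eulerian_norm n (Suc k))\<^sup>2"
    using assms log_concave_eulerian_norm[of n]
    by (intro mult_left_mono) (auto simp: log_concave_iff)
  also have "\<dots> = (real k + 1) * (real n - 2 - real k) * (eulerian_ratio n (Suc k))\<^sup>2"
    by (simp add: ratio_eq_norm power_mult_distrib)
  finally show ?thesis .
qed

lemma eulerian_ratio_uniform_gap:
  assumes "Suc (Suc k) < n"
  shows "(real n + 2)\<^sup>2 * (eulerian_ratio n k * eulerian_ratio n (Suc (Suc k)))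
       \<le> (real n)\<^sup>2 * (eulerian_ratio n (Suc k))\<^sup>2"
proof -
  define \<kappa> where "\<kappa> = (real k + 1) * (real n - 2 - real k)"
  define p where "p = eulerian_ratio n k * eulerian_ratio n (Suc (Suc k))"
  define q where "q = (eulerian_ratio n (Suc k))\<^sup>2"
  have "0 \<le> p" by (simp add: p_def eulerian_ratio_nonneg)
  have "0 < \<kappa>" using assms by (simp add: \<kappa>_def)
  have "4 * \<kappa> = (real n - 1)\<^sup>2 - (2 * real k + 3 - real n)\<^sup>2"
    unfolding \<kappa>_def by algebra
  then have "(4 * \<kappa>) * (real n + 1) \<le> (real n - 1)\<^sup>2 * (real n + 1)"
    by (intro mult_right_mono) auto
  also have "\<dots> = (real n)\<^sup>2 * real n - ((real n)\<^sup>2 + (real n - 1))"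
    by algebra
  also have "\<dots> \<le> (real n)\<^sup>2 * real n"
  proof -
    have "0 \<le> (real n)\<^sup>2 + (real n - 1)"
      using assms by (intro add_nonneg_nonneg) auto
    then show ?thesis by linarith
  qed
  finally have "\<kappa> * (real n + 2)\<^sup>2 \<le> (\<kappa> + real n) * (real n)\<^sup>2"
    by (simp add: power2_eq_square algebra_simps)
  then have "\<kappa> * (real n + 2)\<^sup>2 * p \<le> (\<kappa> + real n) * (real n)\<^sup>2 * p"
    using \<open>0 \<le> p\<close> by (intro mult_right_mono)
  also have "\<dots> = (real n)\<^sup>2 * ((\<kappa> + real n) * p)" by simp
  also have "\<dots> \<le> (real n)\<^sup>2 * (\<kappa> * q)"
    using eulerian_ratio_gap[OF assms]
    by (intro mult_left_mono) (simp_all add: \<kappa>_def p_def q_def algebra_simps)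
  finally have "\<kappa> * ((real n + 2)\<^sup>2 * p) \<le> \<kappa> * ((real n)\<^sup>2 * q)"
    by (simp only: mult_ac)
  then show ?thesis
    using \<open>0 < \<kappa>\<close> by (simp add: p_def q_def)
qed

section \<open>Perturbing the Eulerian numbers by their differences\<close>

lemma two_power_ge_square:
  "6 \<le> n \<Longrightarrow> 2 * (real n)\<^sup>2 + 2 \<le> 2 ^ n + 2 * real n"
proof (induction n rule: nat_induct_at_least)
  case (Suc n)
  have "6 * real n \<le> (real n)\<^sup>2" "6 \<le> real n"
    using Suc.hyps unfolding power2_eq_square by (auto intro: mult_right_mono)
  moreover have "(real (Suc n))\<^sup>2 = (real n)\<^sup>2 + 2 * real n + 1"
    by (simp add: power2_eq_square algebra_simps)
  moreover have "real (Suc n) = real n + 1" "(2::real) ^ Suc n = 2 * 2 ^ n"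
    by simp_all
  ultimately show ?case
    using Suc.IH by linarith
qed simp

lemma eulerian_1_right_ge:
  assumes "5 \<le> n"
  shows "(real n + 1 + of_bool (even n)) * (real n - 1) \<le> eulerian n 1"
proof (cases "n = 5")
  case True
  then show ?thesis
    unfolding eulerian_1_right by simp
next
  case False
  then have "2 * (real n)\<^sup>2 + 2 \<le> 2 ^ n + 2 * real n"
    using assms by (intro two_power_ge_square) simp
  moreover have "5 * real n \<le> (real n)\<^sup>2"
    unfolding power2_eq_square using assms by (intro mult_right_mono) auto
  moreover have "(real n + 1 + of_bool (even n)) * (real n - 1) \<le> (real n + 2) * (real n - 1)"
    using assms by (intro mult_right_mono) auto
  moreover have "(real n + 2) * (real n - 1) = (real n)\<^sup>2 + real n - 2"
    by algebra
  ultimately show ?thesis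
    using assms unfolding eulerian_1_right by linarith
qed

lemma eulerian_diff_coeff_1_le:
  assumes "1 \<le> a + b" "b \<le> Suc a"
  shows "(real (a + b) + 1 + of_bool (a = b)) * eulerian_diff a b 1 \<le> eulerian (a + b) 1"
proof -
  define n x :: real where "n = real (a + b)" and "x = 2 ^ b"
  show ?thesis
  proof (cases "a = b")
    case True
    have "x\<^sup>2 - n - 1 - (n + 2) * (x - n - 1) = (x - n / 2 - 1)\<^sup>2 + (3 * n\<^sup>2 / 4 + n)"
      by (simp add: power2_eq_square field_simps)
    also have "\<dots> \<ge> 0" by (simp add: n_def)
    finally have "(n + 2) * (x - n - 1) \<le> x\<^sup>2 - n - 1" by simp
    then show ?thesis
      unfolding eulerian_diff_coeff_1 eulerian_1_right n_def[symmetric] x_def[symmetric]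
      by (simp add: True x_def power_add power2_eq_square add.commute)
  next
    case False
    have "x\<^sup>2 = 2 ^ (2 * b)"
      by (simp add: x_def power_mult mult.commute)
    also have "\<dots> \<le> 2 ^ Suc (a + b)"
      using assms(2) by (intro power_increasing) auto
    finally have "x\<^sup>2 \<le> 2 * 2 ^ (a + b)" by simp
    moreover have "2 * ((n + 1) * (x - n - 1)) = x\<^sup>2 - 2 * n - 2 - ((x - n - 1)\<^sup>2 + (n\<^sup>2 - 1))"
      by algebra
    moreover have "0 \<le> (x - n - 1)\<^sup>2 + (n\<^sup>2 - 1)"
      using assms(1) by (intro add_nonneg_nonneg) (auto simp: n_def)
    ultimately have "(n + 1) * (x - n - 1) \<le> 2 ^ (a + b) - n - 1"
      by (smt (verit))
    then show ?thesis
      unfolding eulerian_diff_coeff_1 eulerian_1_right n_def[symmetric] x_def[symmetric]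
      by (simp add: False)
  qed
qed

lemma eulerian_diff_coeff_1_bound:
  assumes "5 \<le> a + b" "1 \<le> b" "b \<le> Suc a"
  shows "(real (a + b) + 1 + of_bool (a = b)) * \<bar>eulerian_diff a b 1\<bar> \<le> eulerian (a + b) 1"
proof (cases "0 \<le> eulerian_diff a b 1")
  case True
  then show ?thesis
    using eulerian_diff_coeff_1_le[of a b] assms by simp
next
  case False
  have "(2 :: real) ^ 1 \<le> 2 ^ b"
    using assms(2) by (intro power_increasing) auto
  then have "\<bar>eulerian_diff a b 1\<bar> \<le> real (a + b) - 1"
    using False unfolding eulerian_diff_coeff_1 by simp
  then have "(real (a + b) + 1 + of_bool (a = b)) * \<bar>eulerian_diff a b 1\<bar>
      \<le> (real (a + b) + 1 + of_bool (even (a + b))) * (real (a + b) - 1)"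
    by (intro mult_mono) auto
  also have "\<dots> \<le> eulerian (a + b) 1"
    by (rule eulerian_1_right_ge[OF assms(1)])
  finally show ?thesis .
qed

lemma eulerian_diff_Suc_order_bound:
  assumes "0 \<le> w" "Suc (Suc k) \<le> a + b"
    and "w * \<bar>eulerian_diff a b k\<bar> \<le> eulerian (a + b) k"
    and "w * \<bar>eulerian_diff a b (Suc k)\<bar> \<le> eulerian (a + b) (Suc k)"
  shows "2 * w * \<bar>eulerian_diff (Suc a) b (Suc k)\<bar> \<le> eulerian (Suc (a + b)) (Suc k)"
proof -
  have "2 * w * \<bar>eulerian_diff (Suc a) b (Suc k)\<bar>
      \<le> 2 * w * (\<bar>eulerian_diff a b (Suc k)\<bar> + \<bar>eulerian_diff a b k\<bar>)"
    using assms(1) by (intro mult_left_mono) (auto simp: eulerian_diff_Suc_order)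
  also have "\<dots> = 2 * (w * \<bar>eulerian_diff a b (Suc k)\<bar> + w * \<bar>eulerian_diff a b k\<bar>)"
    by (simp add: algebra_simps)
  also have "\<dots> \<le> 2 * (eulerian (a + b) (Suc k) + eulerian (a + b) k)"
    using assms(3,4) by simp
  also have "\<dots> \<le> eulerian (Suc (a + b)) (Suc k)"
    using assms(2) by (rule eulerian_Suc_Suc_ge)
  finally show ?thesis .
qed

lemma eulerian_diff_Suc_row_bound:
  assumes "0 \<le> w" "k \<le> a + b"
    and "w * \<bar>eulerian_diff a b k\<bar> \<le> eulerian (a + b) k"
    and "w * \<bar>eulerian_diff a b (Suc k)\<bar> \<le> eulerian (a + b) (Suc k)"
  shows "w * \<bar>eulerian_diff a (Suc b) (Suc k)\<bar> \<le> eulerian (Suc (a + b)) (Suc k)"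
proof -
  have weight_nonneg: "0 \<le> real (a + b) - real k" using assms(2) by simp
  have "\<bar>eulerian_diff a (Suc b) (Suc k)\<bar>
      \<le> (real k + 2) * \<bar>eulerian_diff a b (Suc k)\<bar>
        + (real (a + b) - real k) * \<bar>eulerian_diff a b k\<bar>"
    unfolding eulerian_diff_Suc_row using weight_nonneg
    by (intro order_trans[OF abs_triangle_ineq]) (simp add: abs_mult)
  then have "w * \<bar>eulerian_diff a (Suc b) (Suc k)\<bar>
      \<le> w * ((real k + 2) * \<bar>eulerian_diff a b (Suc k)\<bar>
        + (real (a + b) - real k) * \<bar>eulerian_diff a b k\<bar>)"
    using assms(1) by (rule mult_left_mono)
  also have "\<dots> = (real k + 2) * (w * \<bar>eulerian_diff a b (Suc k)\<bar>)
      + (real (a + b) - real k) * (w * \<bar>eulerian_diff a b k\<bar>)"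
    by (simp add: algebra_simps)
  also have "\<dots> \<le> (real k + 2) * eulerian (a + b) (Suc k)
      + (real (a + b) - real k) * eulerian (a + b) k"
    using assms(3,4) weight_nonneg by (intro add_mono mult_left_mono) auto
  finally show ?thesis by (simp only: eulerian_Suc_Suc)
qed

lemma eulerian_diff_edge_bound:
  assumes "5 \<le> n" "n = a + b" "1 \<le> b" "b \<le> Suc a" "k = 1 \<or> Suc (Suc k) = n"
  shows "(real n + 1 + of_bool (a = b)) * \<bar>eulerian_diff a b k\<bar> \<le> eulerian n k"
proof -
  have "\<bar>eulerian_diff a b k\<bar> = \<bar>eulerian_diff a b 1\<bar>" "eulerian n k = eulerian n 1"
    using assms eulerian_symmetric[of k 1 n] eulerian_diff_symmetric[of b k 1 a]
    by (auto simp: abs_mult)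
  then show ?thesis
    using eulerian_diff_coeff_1_bound[of a b] assms by simp
qed

lemma eulerian_diff_bound_5:
  assumes "5 = a + b" "1 \<le> b" "b \<le> Suc a" "0 < k" "Suc k < 5"
  shows "(real 5 + 1 + of_bool (a = b)) * \<bar>eulerian_diff a b k\<bar> \<le> eulerian 5 k"
proof -
  consider (edge) "k = 1 \<or> Suc (Suc k) = 5" | (middle) "k = 2"
    using assms by linarith
  then show ?thesis
  proof cases
    case edge
    then show ?thesis
      using assms by (intro eulerian_diff_edge_bound) auto
  next
    case middle
    consider "a = 4" "b = 1" | "a = 3" "b = 2" | "a = 2" "b = 3"
      using assms by linarith
    then show ?thesis
      by cases (simp_all add: middle numeral_eq_Suc eulerian_diff_Suc_order eulerian_diff_order_0
          eulerian_Suc_Suc eulerian_0_left eulerian_diff_coeff_0)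
  qed
qed

lemma eulerian_diff_interior_bound_Suc:
  assumes IH: "\<And>a b k. n = a + b \<Longrightarrow> 1 \<le> b \<Longrightarrow> b \<le> Suc a \<Longrightarrow> 0 < k \<Longrightarrow> Suc k < n \<Longrightarrow>
      (real n + 1 + of_bool (a = b)) * \<bar>eulerian_diff a b k\<bar> \<le> eulerian n k"
    and "5 \<le> n" "Suc n = a + b" "1 \<le> b" "b \<le> Suc a" "0 < k" "Suc (Suc k) < n"
  shows "(real (Suc n) + 1 + of_bool (a = b)) * \<bar>eulerian_diff a b (Suc k)\<bar>
    \<le> eulerian (Suc n) (Suc k)"
proof (cases "b = Suc a")
  case True
  then have n_eq: "n = a + a" "1 \<le> a"
    using assms(2,3) by auto
  have "(real n + 2) * \<bar>eulerian_diff a a i\<bar> \<le> eulerian n i" if "0 < i" "Suc i < n" for i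
    using IH[of a a i] n_eq that by (simp add: add.commute)
  then show ?thesis
    using True n_eq assms(6,7) eulerian_diff_Suc_row_bound[of "real n + 2" k a a]
    by (simp add: add.commute)
next
  case False
  then obtain c where c_props: "a = Suc c" "n = c + b" "b \<le> Suc c"
    using assms(2-5) by (cases a) auto
  have "(real n + 1) * \<bar>eulerian_diff c b i\<bar> \<le> eulerian n i" if "0 < i" "Suc i < n" for i
  proof -
    have "(real n + 1) * \<bar>eulerian_diff c b i\<bar>
        \<le> (real n + 1 + of_bool (c = b)) * \<bar>eulerian_diff c b i\<bar>"
      by (intro mult_right_mono) auto
    also have "\<dots> \<le> eulerian n i"
      using IH[of c b i] c_props assms(4) that by simp
    finally show ?thesis .
  qed
  then have "2 * (real n + 1) * \<bar>eulerian_diff a b (Suc k)\<bar> \<le> eulerian (Suc n) (Suc k)"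
    using c_props assms(6,7) eulerian_diff_Suc_order_bound[of "real n + 1" k c b] by simp
  moreover have "(real (Suc n) + 1 + of_bool (a = b)) * \<bar>eulerian_diff a b (Suc k)\<bar>
      \<le> 2 * (real n + 1) * \<bar>eulerian_diff a b (Suc k)\<bar>"
    using assms(2) by (intro mult_right_mono) auto
  ultimately show ?thesis by (rule order_trans[rotated])
qed

text \<open>The case \<open>a = b\<close> is sharpened by one because the step from \<open>(a, a)\<close> to \<open>(a, a + 1)\<close>
  raises \<open>n\<close> but preserves the factor, whereas raising \<open>a\<close> doubles it.\<close>

lemma eulerian_diff_bound:
  assumes "5 \<le> n" "n = a + b" "1 \<le> b" "b \<le> Suc a" "0 < k" "Suc k < n"
  shows "(real n + 1 + of_bool (a = b)) * \<bar>eulerian_diff a b k\<bar> \<le> eulerian n k"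
  using assms
proof (induction n arbitrary: a b k rule: nat_induct_at_least)
  case base
  then show ?case by (rule eulerian_diff_bound_5)
next
  case (Suc n)
  consider (edge) "k = 1 \<or> Suc (Suc k) = Suc n"
    | (interior) j where "k = Suc j" "0 < j" "Suc (Suc j) < n"
    using Suc.prems by (cases k; cases "k = 1"; force)
  then show ?case
  proof cases
    case edge
    then show ?thesis
      using Suc.prems Suc.hyps by (intro eulerian_diff_edge_bound) auto
  next
    case interior
    show ?thesis
      unfolding interior(1)
      using Suc.IH Suc.hyps Suc.prems(1-3) interior(2,3)
      by (rule eulerian_diff_interior_bound_Suc)
  qed
qed

lemma eulerian_diff_row_1: "eulerian_diff a 1 k = (-1) ^ k * real (a choose k)"
proof (induction a arbitrary: k)
  case 0
  show ?case
    using eulerian_eq_0[of 1 k] by (cases k) (auto simp: eulerian_diff_order_0)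
next
  case (Suc a)
  then show ?case
    by (cases k) (simp_all add: eulerian_diff_coeff_0 eulerian_diff_Suc_order algebra_simps)
qed

lemma eulerian_ratio_gap_0:
  assumes "3 \<le> n"
  shows "2 * (real n - 1) * eulerian_ratio n 2 \<le> (real n - 2) * (eulerian_ratio n 1)\<^sup>2"
  using eulerian_ratio_gap[of 0 n] assms
  by (simp add: numeral_2_eq_2 eulerian_ratio_0_right)

lemma eulerian_ratio_edge_nonneg:
  assumes "3 \<le> n" "0 \<le> d" and e_small: "(real n + 1) * \<bar>e\<bar> \<le> eulerian_ratio n 2"
  shows "2 * (eulerian_ratio n 2 + e) \<le> (eulerian_ratio n 1 + d)\<^sup>2"
proof -
  define q r where "q = eulerian_ratio n 1" and "r = eulerian_ratio n 2"
  have "0 \<le> q" "0 \<le> r" by (simp_all add: q_def r_def eulerian_ratio_nonneg)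
  have "(real n + 1) * e \<le> r"
    using e_small by (intro order_trans[OF mult_left_mono[of e "\<bar>e\<bar>"]]) (auto simp: r_def)
  then have "(real n - 2) * ((real n + 1) * (2 * (r + e)))
      \<le> (real n - 2) * (2 * ((real n + 2) * r))"
    using \<open>3 \<le> n\<close> by (intro mult_left_mono) (auto simp: algebra_simps)
  also have "\<dots> \<le> 2 * ((real n - 1) * (real n + 1)) * r"
  proof -
    have "2 * ((real n - 2) * (real n + 2)) * r \<le> 2 * ((real n - 1) * (real n + 1)) * r"
      using \<open>0 \<le> r\<close> by (intro mult_right_mono) (auto simp: algebra_simps)
    then show ?thesis by (simp only: mult_ac)
  qed
  also have "\<dots> = (real n + 1) * (2 * (real n - 1) * r)" by simp
  also have "\<dots> \<le> (real n + 1) * ((real n - 2) * q\<^sup>2)"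
    using eulerian_ratio_gap_0[OF \<open>3 \<le> n\<close>] by (intro mult_left_mono) (auto simp: q_def r_def)
  also have "\<dots> = (real n - 2) * ((real n + 1) * q\<^sup>2)" by simp
  finally have "2 * (r + e) \<le> q\<^sup>2"
    using \<open>3 \<le> n\<close> by (simp add: mult_le_cancel_left_pos)
  also have "\<dots> \<le> (q + d)\<^sup>2"
    using \<open>0 \<le> q\<close> \<open>0 \<le> d\<close> by (intro power_mono) auto
  finally show ?thesis by (simp only: q_def r_def)
qed

lemma eulerian_ratio_edge_minus_1:
  assumes "5 \<le> n"
  shows "2 * (eulerian_ratio n 2 + 1) \<le> (eulerian_ratio n 1 - 1)\<^sup>2"
proof (cases "n = 5")
  case True
  have "eulerian_ratio 5 1 = 13 / 2"
    unfolding eulerian_ratio_def eulerian_1_right by simp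
  moreover have "eulerian_ratio 5 2 = 11"
    by (simp add: eulerian_ratio_def numeral_eq_Suc eulerian_Suc_Suc eulerian_0_left)
  ultimately show ?thesis
    unfolding True by (simp only: power2_eq_square) simp
next
  case False
  define q r where "q = eulerian_ratio n 1" and "r = eulerian_ratio n 2"
  have "(2 * real n - 1) * (real n - 1) \<le> eulerian n 1"
    using two_power_ge_square[of n] False assms unfolding eulerian_1_right
    by (simp add: power2_eq_square algebra_simps)
  then have q_ge: "2 * real n - 1 \<le> q"
    using assms by (simp add: q_def eulerian_ratio_def pos_le_divide_eq)
  then have "(2 * real n - 1) * q \<le> q * q"
    using assms by (intro mult_right_mono) auto
  then have "(real n - 2) * q\<^sup>2 + 2 * (real n - 1) \<le> (real n - 1) * (q - 1)\<^sup>2"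
    using q_ge assms by (simp add: power2_eq_square algebra_simps)
  then have "(real n - 1) * (2 * (r + 1)) \<le> (real n - 1) * (q - 1)\<^sup>2"
    using eulerian_ratio_gap_0[of n] assms by (simp add: q_def r_def algebra_simps)
  then show ?thesis
    using assms by (simp add: q_def r_def)
qed

definition eulerian_diff_ratio :: "nat \<Rightarrow> nat \<Rightarrow> nat \<Rightarrow> real" where
  "eulerian_diff_ratio a b k = eulerian_diff a b k / real (a + b - 1 choose k)"

lemma eulerian_diff_ratio_coeff_0: "eulerian_diff_ratio a b 0 = 1"
  by (simp add: eulerian_diff_ratio_def eulerian_diff_coeff_0)

lemma eulerian_diff_ratio_symmetric:
  assumes "0 < b" "Suc (j + k) = a + b"
  shows "eulerian_diff_ratio a b j = (-1) ^ a * eulerian_diff_ratio a b k"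
proof -
  have "a + b - 1 = j + k"
    using assms(2) by simp
  then show ?thesis
    using eulerian_diff_symmetric[OF assms] binomial_symmetric[of j "j + k"]
    by (simp add: eulerian_diff_ratio_def)
qed

lemma eulerian_diff_ratio_bound:
  assumes "5 \<le> n" "n = a + b" "1 \<le> b" "b \<le> Suc a" "0 < k" "Suc k < n"
  shows "(real n + 1) * \<bar>eulerian_diff_ratio a b k\<bar> \<le> eulerian_ratio n k"
proof -
  have "(real n + 1) * \<bar>eulerian_diff a b k\<bar>
      \<le> (real n + 1 + of_bool (a = b)) * \<bar>eulerian_diff a b k\<bar>"
    by (intro mult_right_mono) auto
  also have "\<dots> \<le> eulerian n k"
    by (rule eulerian_diff_bound[OF assms])
  finally show ?thesis
    using assms(2) by (simp add: eulerian_diff_ratio_def eulerian_ratio_def divide_right_mono)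
qed

lemma eulerian_diff_ratio_edge:
  assumes indices: "5 \<le> n" "n = a + b" and b_cases: "1 \<le> b" "b \<le> Suc a" "b = 1 \<or> n < 2 ^ b"
  shows "2 * (eulerian_ratio n 2 + eulerian_diff_ratio a b 2)
    \<le> (eulerian_ratio n 1 + eulerian_diff_ratio a b 1)\<^sup>2"
proof (cases "b = 1")
  case True
  then have "eulerian_diff_ratio a b 2 = 1" "eulerian_diff_ratio a b 1 = -1"
    using indices
    by (simp_all add: eulerian_diff_ratio_def eulerian_diff_row_1[unfolded One_nat_def])
  then show ?thesis
    using eulerian_ratio_edge_minus_1[OF indices(1)] by simp
next
  case False
  then have "real (Suc n) \<le> real (2 ^ b)"
    using b_cases(3) by (simp only: of_nat_le_iff Suc_le_eq) simp
  then have "0 \<le> eulerian_diff_ratio a b 1"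
    by (simp add: eulerian_diff_ratio_def eulerian_diff_coeff_1[unfolded One_nat_def] indices(2))
  moreover have "(real n + 1) * \<bar>eulerian_diff_ratio a b 2\<bar> \<le> eulerian_ratio n 2"
    using indices b_cases by (intro eulerian_diff_ratio_bound) auto
  ultimately show ?thesis
    using indices(1) by (intro eulerian_ratio_edge_nonneg) auto
qed

lemma log_concave_eulerian_ratio_perturb:
  assumes indices: "5 \<le> n" "n = a + b" and b_cases: "1 \<le> b" "b \<le> Suc a" "b = 1 \<or> n < 2 ^ b"
    and sign: "\<sigma> \<in> {1, -1}"
  shows "log_concave (n - 1) (\<lambda>k. eulerian_ratio n k + \<sigma> * eulerian_diff_ratio a b k)"
proof (rule log_concave_perturb_symmetric[OF _ _ sign, where \<tau> = "(-1) ^ a"])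
  let ?\<delta> = "1 / (real n + 1)"
  show "0 \<le> ?\<delta>" "?\<delta> \<le> 1"
    by simp_all
  show "(-1) ^ a \<in> {1, -1 :: real}"
    by (cases "even a") auto
  show "\<bar>eulerian_diff_ratio a b k\<bar> \<le> ?\<delta> * eulerian_ratio n k" if "0 < k" "k < n - 1" for k
    using eulerian_diff_ratio_bound[OF indices b_cases(1,2) that(1)] that(2)
    by (simp add: field_simps)
  show "(1 + ?\<delta>)\<^sup>2 * (eulerian_ratio n k * eulerian_ratio n (Suc (Suc k)))
      \<le> (1 - ?\<delta>)\<^sup>2 * (eulerian_ratio n (Suc k))\<^sup>2" if "Suc (Suc k) \<le> n - 1" for k
  proof -
    have "1 + ?\<delta> = (real n + 2) / (real n + 1)" "1 - ?\<delta> = real n / (real n + 1)"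
      by (simp_all add: field_simps)
    then show ?thesis
      using eulerian_ratio_uniform_gap[of k n] that by (simp add: power_divide divide_right_mono)
  qed
  show "(eulerian_ratio n 0 + eulerian_diff_ratio a b 0)
      * (eulerian_ratio n 2 + eulerian_diff_ratio a b 2)
      \<le> (eulerian_ratio n 1 + eulerian_diff_ratio a b 1)\<^sup>2"
    using eulerian_diff_ratio_edge[OF indices b_cases]
    by (simp add: eulerian_ratio_0_right eulerian_diff_ratio_coeff_0)
  fix j k assume "j + k = n - 1"
  then have "Suc (j + k) = n" using indices(1) by simp
  then show "eulerian_ratio n j = eulerian_ratio n k"
    "eulerian_diff_ratio a b j = (-1) ^ a * eulerian_diff_ratio a b k"
    using indices(2) b_cases(1)
    by (simp_all add: eulerian_ratio_symmetric eulerian_diff_ratio_symmetric)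
qed (simp_all add: eulerian_ratio_nonneg eulerian_ratio_0_right eulerian_diff_ratio_coeff_0)

section \<open>Parity-weighted generating polynomials\<close>

definition parity_weight :: "real \<Rightarrow> (nat \<Rightarrow> nat) \<Rightarrow> real" where
  "parity_weight \<epsilon> \<pi> = (if evenperm \<pi> then 1 else \<epsilon>)"

lemma parity_weight_compose_transpose:
  assumes "\<epsilon> * \<epsilon> = 1" "permutation \<pi>" "a \<noteq> b"
  shows "parity_weight \<epsilon> (Transposition.transpose a b \<circ> \<pi>) = \<epsilon> * parity_weight \<epsilon> \<pi>"
    and "parity_weight \<epsilon> (\<pi> \<circ> Transposition.transpose a b) = \<epsilon> * parity_weight \<epsilon> \<pi>"
  using assms by (auto simp: parity_weight_def evenperm_comp evenperm_swap permutation_swap_id)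

definition stat_poly :: "real \<Rightarrow> nat \<Rightarrow> ((nat \<Rightarrow> nat) \<Rightarrow> nat) \<Rightarrow> real poly" where
  "stat_poly \<epsilon> n f = (\<Sum>\<pi> | \<pi> permutes {1..n}. monom (parity_weight \<epsilon> \<pi>) (f \<pi>))"

lemma stat_poly_0: "stat_poly \<epsilon> 0 f = monom 1 (f id)"
  by (simp add: stat_poly_def parity_weight_def)

lemma coeff_stat_poly:
  "coeff (stat_poly \<epsilon> n f) k = (\<Sum>\<pi> | \<pi> permutes {1..n} \<and> f \<pi> = k. parity_weight \<epsilon> \<pi>)"
proof -
  have "coeff (stat_poly \<epsilon> n f) k
      = (\<Sum>\<pi> | \<pi> permutes {1..n}. if f \<pi> = k then parity_weight \<epsilon> \<pi> else 0)"
    by (simp add: stat_poly_def coeff_sum)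
  also have "\<dots> = (\<Sum>\<pi> | \<pi> permutes {1..n} \<and> f \<pi> = k. parity_weight \<epsilon> \<pi>)"
    by (subst sum.inter_filter[symmetric]) (simp_all add: finite_permutations)
  finally show ?thesis .
qed

lemma card_parity_eq_coeff:
  "real (card {\<pi>. \<pi> permutes {1..n} \<and> evenperm \<pi> \<and> f \<pi> = k})
    = (coeff (stat_poly 1 n f) k + coeff (stat_poly (-1) n f) k) / 2" (is ?even)
  "real (card {\<pi>. \<pi> permutes {1..n} \<and> \<not> evenperm \<pi> \<and> f \<pi> = k})
    = (coeff (stat_poly 1 n f) k - coeff (stat_poly (-1) n f) k) / 2" (is ?odd)
proof -
  define X where "X = {\<pi>. \<pi> permutes {1..n} \<and> f \<pi> = k}"
  have "finite X"
    by (simp add: X_def finite_permutations)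
  have sum_if_eq_card: "(\<Sum>\<pi>\<in>X. if P \<pi> then 2 else 0) = 2 * real (card {\<pi> \<in> X. P \<pi>})" for P
    using \<open>finite X\<close> by (simp flip: sum.inter_filter)
  have "coeff (stat_poly 1 n f) k + coeff (stat_poly (-1) n f) k
      = (\<Sum>\<pi>\<in>X. if evenperm \<pi> then 2 else 0)"
    unfolding coeff_stat_poly sum.distrib[symmetric] X_def
    by (intro sum.cong) (auto simp: parity_weight_def)
  then show ?even
    unfolding sum_if_eq_card by (simp add: X_def conj_commute conj_left_commute)
  have "coeff (stat_poly 1 n f) k - coeff (stat_poly (-1) n f) k
      = (\<Sum>\<pi>\<in>X. if \<not> evenperm \<pi> then 2 else 0)"
    unfolding coeff_stat_poly sum_subtractf[symmetric] X_def
    by (intro sum.cong) (auto simp: parity_weight_def)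
  then show ?odd
    unfolding sum_if_eq_card by (simp add: X_def conj_commute conj_left_commute)
qed

lemma ultra_log_concave_parity_counts:
  assumes indices: "5 \<le> n" "n = a + b" and b_cases: "1 \<le> b" "b \<le> Suc a" "b = 1 \<or> n < 2 ^ b"
    and polys: "stat_poly 1 n f = eulerian_poly n"
      "stat_poly (-1) n f = [:1, -1:] ^ a * eulerian_poly b"
  shows "ultra_log_concave (n - 1)
      (\<lambda>k. real (card {\<pi>. \<pi> permutes {1..n} \<and> evenperm \<pi> \<and> f \<pi> = k}))" (is ?even)
    and "ultra_log_concave (n - 1)
      (\<lambda>k. real (card {\<pi>. \<pi> permutes {1..n} \<and> \<not> evenperm \<pi> \<and> f \<pi> = k}))" (is ?odd)
proof -
  have "(eulerian n k + \<sigma> * eulerian_diff a b k) / 2 / real (n - 1 choose k)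
      = 1 / 2 * (eulerian_ratio n k + \<sigma> * eulerian_diff_ratio a b k)" for \<sigma> k
    by (simp add: eulerian_ratio_def eulerian_diff_ratio_def indices(2) add_divide_distrib)
  then have halves: "log_concave (n - 1)
      (\<lambda>k. (eulerian n k + \<sigma> * eulerian_diff a b k) / 2 / real (n - 1 choose k))"
    if "\<sigma> \<in> {1, -1}" for \<sigma>
    using log_concave_scale[OF log_concave_eulerian_ratio_perturb[OF indices b_cases that],
        of "1 / 2"]
    by (simp only:)
  have "log_concave (n - 1) (\<lambda>k. real (card {\<pi>. \<pi> permutes {1..n} \<and> evenperm \<pi> \<and> f \<pi> = k})
      / real (n - 1 choose k))"
    unfolding card_parity_eq_coeff polys eulerian_def[symmetric] eulerian_diff_def[symmetric]
    using halves[of 1] by simp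
  then show ?even
    by (simp add: ultra_log_concave_def)
  have "log_concave (n - 1) (\<lambda>k. real (card {\<pi>. \<pi> permutes {1..n} \<and> \<not> evenperm \<pi> \<and> f \<pi> = k})
      / real (n - 1 choose k))"
    unfolding card_parity_eq_coeff polys eulerian_def[symmetric] eulerian_diff_def[symmetric]
    using halves[of "-1"] by simp
  then show ?odd
    by (simp add: ultra_log_concave_def)
qed

definition insertion_weight :: "'a \<Rightarrow> nat set \<Rightarrow> nat \<Rightarrow> 'a :: comm_ring_1" where
  "insertion_weight t N i = (if i \<in> N then 1 else t)"

lemma sum_insertion_weight:
  assumes "finite I" "N \<subseteq> I"
  shows "(\<Sum>i\<in>I. insertion_weight t N i)
    = of_nat (card N) + (of_nat (card I) - of_nat (card N)) * t"
proof -
  have "(\<Sum>i\<in>I. insertion_weight t N i)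
      = (\<Sum>i\<in>I - N. insertion_weight t N i) + (\<Sum>i\<in>N. insertion_weight t N i)"
    by (rule sum.subset_diff) fact+
  also have "\<dots> = of_nat (card (I - N)) * t + of_nat (card N)"
    by (simp add: insertion_weight_def)
  also have "of_nat (card (I - N)) = (of_nat (card I) - of_nat (card N) :: 'a)"
    using assms by (simp add: card_Diff_subset finite_subset card_mono)
  finally show ?thesis by (simp add: add.commute)
qed

section \<open>Counting by excedances\<close>

lemma exc_extend_fixed:
  assumes "\<sigma> permutes {1..n}"
  shows "exc (Suc n) \<sigma> = exc n \<sigma>"
proof -
  have "\<sigma> (Suc n) = Suc n" using assms by (intro permutes_not_in) auto
  then have "{i \<in> {1..Suc n}. \<sigma> i > i} = {i \<in> {1..n}. \<sigma> i > i}"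
    by (auto simp: le_Suc_eq)
  then show ?thesis by (simp add: exc_def)
qed

lemma exc_transpose_max:
  assumes perm: "\<sigma> permutes {1..n}" and i_range: "i \<in> {1..n}"
  shows "exc (Suc n) (Transposition.transpose (Suc n) (\<sigma> i) \<circ> \<sigma>) = exc n \<sigma> + of_bool (\<sigma> i \<le> i)"
proof -
  let ?\<pi> = "Transposition.transpose (Suc n) (\<sigma> i) \<circ> \<sigma>"
  have letter_range: "\<sigma> j \<in> {1..n}" if "j \<in> {1..n}" for j
    using permutes_in_image[OF perm] that by blast
  have "\<sigma> j = \<sigma> i \<longleftrightarrow> j = i" for j
    using permutes_inj[OF perm] by (simp add: inj_eq)
  then have word: "?\<pi> j = (if j = i then Suc n else \<sigma> j)" if "j \<in> {1..n}" for j
    using letter_range[OF that] by (auto simp: transpose_def)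
  have "\<sigma> (Suc n) = Suc n"
    using perm by (intro permutes_not_in) auto
  then have "?\<pi> (Suc n) = \<sigma> i" by simp
  then have "{j \<in> {1..Suc n}. ?\<pi> j > j} = insert i {j \<in> {1..n}. \<sigma> j > j}"
    using word i_range letter_range[OF i_range]
    by (auto simp: le_Suc_eq simp del: o_apply split: if_splits)
  then show ?thesis
    using i_range by (simp add: exc_def card_insert_if not_less del: o_apply)
qed

lemma sum_transpose_max_exc:
  assumes "\<epsilon> * \<epsilon> = 1" and perm: "\<sigma> permutes {1..n}"
  defines "F \<equiv> \<lambda>m \<pi>. monom (parity_weight \<epsilon> \<pi>) (exc m \<pi>)"
  shows "(\<Sum>b=1..n. F (Suc n) (Transposition.transpose (Suc n) b \<circ> \<sigma>))
    = [:\<epsilon>:] * eulerian_op n (F n \<sigma>)"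
proof -
  let ?E = "{i \<in> {1..n}. \<sigma> i > i}"
  have summand: "F (Suc n) (Transposition.transpose (Suc n) (\<sigma> i) \<circ> \<sigma>)
      = [:\<epsilon>:] * F n \<sigma> * insertion_weight [:0, 1:] ?E i" if i_range: "i \<in> {1..n}" for i
  proof -
    have "\<sigma> i \<noteq> Suc n" using permutes_in_image[OF perm, of i] i_range by auto
    moreover have "permutation \<sigma>" using perm by (auto simp: permutation_permutes)
    ultimately have "parity_weight \<epsilon> (Transposition.transpose (Suc n) (\<sigma> i) \<circ> \<sigma>)
        = \<epsilon> * parity_weight \<epsilon> \<sigma>"
      using parity_weight_compose_transpose(1)[OF \<open>\<epsilon> * \<epsilon> = 1\<close>] by simp
    then show ?thesis
      using i_range
      by (simp add: F_def exc_transpose_max[OF perm i_range] insertion_weight_def monom_Suc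
          smult_monom del: o_apply)
  qed
  have "(\<Sum>b=1..n. F (Suc n) (Transposition.transpose (Suc n) b \<circ> \<sigma>))
      = (\<Sum>i=1..n. F (Suc n) (Transposition.transpose (Suc n) (\<sigma> i) \<circ> \<sigma>))"
    using sum.permute[OF perm, of "\<lambda>b. F (Suc n) (Transposition.transpose (Suc n) b \<circ> \<sigma>)"]
    by (simp add: comp_def)
  also have "\<dots> = [:\<epsilon>:] * F n \<sigma> * (\<Sum>i=1..n. insertion_weight [:0, 1:] ?E i)"
    unfolding sum_distrib_left by (intro sum.cong summand refl)
  also have "(\<Sum>i=1..n. insertion_weight [:0, 1:] ?E i)
      = of_nat (exc n \<sigma>) + (of_nat n - of_nat (exc n \<sigma>)) * [:0, 1 :: real:]"
    by (subst sum_insertion_weight) (auto simp: exc_def)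
  finally show ?thesis
    by (simp only: F_def eulerian_op_monom mult.assoc)
qed

lemma stat_poly_exc_Suc:
  assumes "\<epsilon> * \<epsilon> = 1"
  shows "stat_poly \<epsilon> (Suc n) (exc (Suc n))
    = stat_poly \<epsilon> n (exc n) + [:\<epsilon>:] * eulerian_op n (stat_poly \<epsilon> n (exc n))"
proof -
  define F where "F m \<pi> = monom (parity_weight \<epsilon> \<pi>) (exc m \<pi>)" for m \<pi>
  let ?S = "{\<sigma>. \<sigma> permutes {1..n}}"
  have "stat_poly \<epsilon> (Suc n) (exc (Suc n)) = (\<Sum>\<pi> | \<pi> permutes insert (Suc n) {1..n}. F (Suc n) \<pi>)"
    by (simp add: stat_poly_def F_def atLeastAtMostSuc_conv)
  also have "\<dots> = (\<Sum>b\<in>insert (Suc n) {1..n}. \<Sum>\<sigma>\<in>?S.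
      F (Suc n) (Transposition.transpose (Suc n) b \<circ> \<sigma>))"
    by (rule sum_over_permutations_insert) auto
  also have "\<dots> = (\<Sum>\<sigma>\<in>?S. F (Suc n) \<sigma>)
      + (\<Sum>b=1..n. \<Sum>\<sigma>\<in>?S. F (Suc n) (Transposition.transpose (Suc n) b \<circ> \<sigma>))"
    by simp
  also have "(\<Sum>\<sigma>\<in>?S. F (Suc n) \<sigma>) = stat_poly \<epsilon> n (exc n)"
    unfolding stat_poly_def F_def by (intro sum.cong) (auto simp: exc_extend_fixed)
  also have "(\<Sum>b=1..n. \<Sum>\<sigma>\<in>?S. F (Suc n) (Transposition.transpose (Suc n) b \<circ> \<sigma>))
      = (\<Sum>\<sigma>\<in>?S. \<Sum>b=1..n. F (Suc n) (Transposition.transpose (Suc n) b \<circ> \<sigma>))"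
    by (rule sum.swap)
  also have "\<dots> = (\<Sum>\<sigma>\<in>?S. [:\<epsilon>:] * eulerian_op n (F n \<sigma>))"
    unfolding F_def by (intro sum.cong refl sum_transpose_max_exc assms) simp
  also have "\<dots> = [:\<epsilon>:] * eulerian_op n (stat_poly \<epsilon> n (exc n))"
    by (simp only: stat_poly_def F_def eulerian_op_sum sum_distrib_left)
  finally show ?thesis .
qed

lemma stat_poly_exc_1: "stat_poly 1 n (exc n) = eulerian_poly n"
  by (induction n) (simp_all add: stat_poly_exc_Suc, simp add: stat_poly_0 exc_def)

lemma stat_poly_exc_minus_1: "stat_poly (-1) (Suc n) (exc (Suc n)) = [:1, -1:] ^ n"
proof (induction n)
  case 0
  show ?case
    by (subst stat_poly_exc_Suc) (simp_all add: stat_poly_0 exc_def eulerian_op_def)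
next
  case (Suc n)
  have "eulerian_op (Suc n) ([:1, -1:] ^ n) = [:1, -1:] ^ n * [:0, 1:]"
    using eulerian_op_power_mult[of n 1 1] by (simp add: eulerian_op_def)
  then have "stat_poly (-1) (Suc (Suc n)) (exc (Suc (Suc n)))
      = [:1, -1:] ^ n - [:1, -1:] ^ n * [:0, 1:]"
    by (simp only: stat_poly_exc_Suc[of "-1" "Suc n"] Suc.IH) simp
  also have "\<dots> = [:1, -1:] ^ Suc n" by simp
  finally show ?case .
qed

section \<open>Counting by descents\<close>

definition insert_max :: "nat \<Rightarrow> nat \<Rightarrow> (nat \<Rightarrow> nat) \<Rightarrow> nat \<Rightarrow> nat" where
  "insert_max n i \<sigma> q =
    (if q = Suc i then Suc n else if Suc i < q \<and> q \<le> Suc n then \<sigma> (q - 1) else \<sigma> q)"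

lemma insert_max_at_end:
  assumes "\<sigma> permutes {1..n}"
  shows "insert_max n n \<sigma> = \<sigma>"
  using permutes_not_in[OF assms, of "Suc n"] by (auto simp: insert_max_def fun_eq_iff)

lemma insert_max_eq_comp_transpose:
  "i < n \<Longrightarrow> insert_max n i \<sigma>
    = insert_max n (Suc i) \<sigma> \<circ> Transposition.transpose (Suc i) (Suc (Suc i))"
  by (auto simp: insert_max_def fun_eq_iff transpose_def)

lemma insert_max_permutes:
  assumes "i \<le> n" "\<sigma> permutes {1..n}"
  shows "insert_max n i \<sigma> permutes {1..Suc n}"
  using assms(1)
proof (induction i rule: inc_induct)
  case base
  show ?case
    unfolding insert_max_at_end[OF assms(2)] using assms(2) by (rule permutes_subset) auto
next
  case (step i)
  then show ?case
    unfolding insert_max_eq_comp_transpose[OF step.hyps(2)]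
    by (intro permutes_compose permutes_swap_id) auto
qed

lemma parity_weight_insert_max:
  assumes "i \<le> n" "\<sigma> permutes {1..n}" "\<epsilon> * \<epsilon> = 1"
  shows "parity_weight \<epsilon> (insert_max n i \<sigma>) = \<epsilon> ^ (n + i) * parity_weight \<epsilon> \<sigma>"
  using assms(1)
proof (induction i rule: inc_induct)
  case base
  have "\<epsilon> ^ (n + n) = 1"
    using assms(3) by (simp add: power_add flip: power_mult_distrib)
  then show ?case
    by (simp add: insert_max_at_end[OF assms(2)])
next
  case (step i)
  have "insert_max n (Suc i) \<sigma> permutes {1..Suc n}"
    using step.hyps assms(2) by (intro insert_max_permutes) auto
  then have "permutation (insert_max n (Suc i) \<sigma>)"
    by (auto simp: permutation_permutes)
  then have "parity_weight \<epsilon> (insert_max n i \<sigma>) = \<epsilon> * (\<epsilon> ^ (n + Suc i) * parity_weight \<epsilon> \<sigma>)"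
    using parity_weight_compose_transpose(2)[OF assms(3)] step
    by (simp add: insert_max_eq_comp_transpose[OF step.hyps(2)])
  also have "\<dots> = (\<epsilon> * \<epsilon>) * (\<epsilon> ^ (n + i) * parity_weight \<epsilon> \<sigma>)"
    by simp
  finally show ?case using assms(3) by simp
qed

lemma insert_max_eq_max_iff:
  assumes "\<sigma> permutes {1..n}" "i \<le> n"
  shows "insert_max n i \<sigma> q = Suc n \<longleftrightarrow> q = Suc i"
proof -
  have "insert_max n i \<sigma> (Suc i) = Suc n"
    by (simp add: insert_max_def)
  then show ?thesis
    using permutes_inj[OF insert_max_permutes[OF assms(2,1)]] by (metis injD)
qed

lemma inj_on_insert_max:
  "inj_on (\<lambda>(\<sigma>, i). insert_max n i \<sigma>) ({\<sigma>. \<sigma> permutes {1..n}} \<times> {..n})"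
proof (rule inj_onI)
  fix x y
  assume x_y: "x \<in> {\<sigma>. \<sigma> permutes {1..n}} \<times> {..n}" "y \<in> {\<sigma>. \<sigma> permutes {1..n}} \<times> {..n}"
    "(\<lambda>(\<sigma>, i). insert_max n i \<sigma>) x = (\<lambda>(\<sigma>, i). insert_max n i \<sigma>) y"
  obtain \<sigma> \<tau> i j where pairs: "x = (\<sigma>, i)" "y = (\<tau>, j)"
    by (metis surj_pair)
  with x_y have \<sigma>_i: "\<sigma> permutes {1..n}" "i \<le> n" and \<tau>_j: "\<tau> permutes {1..n}" "j \<le> n"
    and eq: "insert_max n i \<sigma> = insert_max n j \<tau>"
    by auto
  have "i = j"
    using insert_max_eq_max_iff[of \<sigma> n i "Suc i"] insert_max_eq_max_iff[of \<tau> n j "Suc i"]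
      \<sigma>_i \<tau>_j eq
    by simp
  have "\<sigma> q = \<tau> q" for q
  proof (cases "q \<in> {1..n}")
    case True
    define p where "p = (if q \<le> i then q else Suc q)"
    have "\<sigma> q = insert_max n i \<sigma> p" "\<tau> q = insert_max n i \<tau> p"
      using True by (auto simp: p_def insert_max_def)
    then show ?thesis using eq \<open>i = j\<close> by simp
  next
    case False
    then show ?thesis using \<sigma>_i(1) \<tau>_j(1) by (simp add: permutes_not_in)
  qed
  then show "x = y" using pairs \<open>i = j\<close> by auto
qed

lemma sum_permutes_insert_max:
  "(\<Sum>\<pi> | \<pi> permutes {1..Suc n}. f \<pi>)
    = (\<Sum>\<sigma> | \<sigma> permutes {1..n}. \<Sum>i\<le>n. f (insert_max n i \<sigma>))"
proof -
  let ?ins = "\<lambda>(\<sigma>, i). insert_max n i \<sigma>" and ?D = "{\<sigma>. \<sigma> permutes {1..n}} \<times> {..n}"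
  have "?ins ` ?D = {\<pi>. \<pi> permutes {1..Suc n}}"
  proof (rule card_subset_eq)
    show "?ins ` ?D \<subseteq> {\<pi>. \<pi> permutes {1..Suc n}}"
      by (auto intro: insert_max_permutes simp del: One_nat_def)
    have "card (?ins ` ?D) = card ?D"
      by (rule card_image[OF inj_on_insert_max])
    also have "\<dots> = card {\<pi>. \<pi> permutes {1..Suc n}}"
      by (simp add: card_cartesian_product card_permutations[OF refl])
    finally show "card (?ins ` ?D) = card {\<pi>. \<pi> permutes {1..Suc n}}" .
  qed (simp add: finite_permutations)
  then have "(\<Sum>\<pi> | \<pi> permutes {1..Suc n}. f \<pi>) = (\<Sum>(\<sigma>, i)\<in>?D. f (insert_max n i \<sigma>))"
    using sum.reindex[OF inj_on_insert_max, of f n] by (simp add: case_prod_unfold comp_def)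
  then show ?thesis
    by (simp add: sum.cartesian_product)
qed

text \<open>Gap \<open>i\<close> lies behind the \<open>i\<close>-th letter; at a level gap a new largest letter leaves the
  number of descents unchanged.\<close>

definition level_gaps :: "nat \<Rightarrow> (nat \<Rightarrow> nat) \<Rightarrow> nat set" where
  "level_gaps n \<pi> = insert n {i \<in> {1..n - 1}. \<pi> i > \<pi> (i + 1)}"

definition split_gap :: "nat \<Rightarrow> nat set \<Rightarrow> nat set" where
  "split_gap i N = {q \<in> N. q < i} \<union> {Suc i} \<union> Suc ` {q \<in> N. i < q}"

lemma level_gaps_subset: "level_gaps n \<pi> \<subseteq> {..n}"
  by (auto simp: level_gaps_def)

lemma card_level_gaps: "card (level_gaps n \<pi>) = Suc (des n \<pi>)"
  by (cases n) (auto simp: level_gaps_def des_def card_insert_if)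

lemma level_gaps_insert_max:
  assumes "\<sigma> permutes {1..n}" "i \<le> n"
  shows "level_gaps (Suc n) (insert_max n i \<sigma>) = split_gap i (level_gaps n \<sigma>)"
proof (rule set_eqI)
  fix q
  have letter_le: "\<sigma> p \<le> n" if "p \<in> {1..n}" for p
    using permutes_in_image[OF assms(1), of p] that by auto
  consider (before) "q < i" | (ascent) "q = i" | (inserted) "q = Suc i"
    | (after) r where "q = Suc r" "i < r"
    by (metis Suc_lessE linorder_neqE_nat not_less_eq)
  then show "q \<in> level_gaps (Suc n) (insert_max n i \<sigma>) \<longleftrightarrow> q \<in> split_gap i (level_gaps n \<sigma>)"
  proof cases
    case before
    then show ?thesis
      using assms(2) by (auto simp: level_gaps_def split_gap_def insert_max_def)
  next
    case ascent
    then show ?thesis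
      using assms(2) letter_le[of i] by (auto simp: level_gaps_def split_gap_def insert_max_def)
  next
    case inserted
    then show ?thesis
      using assms(2) letter_le[of "Suc i"]
      by (auto simp: level_gaps_def split_gap_def insert_max_def)
  next
    case after
    then show ?thesis
      by (auto simp: level_gaps_def split_gap_def insert_max_def)
  qed
qed

lemma card_split_gap:
  assumes "finite N"
  shows "card (split_gap i N) = card N + of_bool (i \<notin> N)"
proof -
  have "split_gap i N = insert (Suc i) ({q \<in> N. q < i} \<union> Suc ` {q \<in> N. i < q})"
    by (auto simp: split_gap_def)
  then have "card (split_gap i N) = Suc (card ({q \<in> N. q < i} \<union> Suc ` {q \<in> N. i < q}))"
    using assms by (simp add: card_insert_if image_iff)
  also have "card ({q \<in> N. q < i} \<union> Suc ` {q \<in> N. i < q})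
      = card {q \<in> N. q < i} + card {q \<in> N. i < q}"
    using assms by (subst card_Un_disjoint) (auto simp: card_image)
  also have "\<dots> = card ({q \<in> N. q < i} \<union> {q \<in> N. i < q})"
    using assms by (subst card_Un_disjoint) auto
  also have "{q \<in> N. q < i} \<union> {q \<in> N. i < q} = N - {i}"
    by auto
  finally show ?thesis
    using assms card_Suc_Diff1[of N i] by (cases "i \<in> N") simp_all
qed

lemma des_insert_max:
  assumes "\<sigma> permutes {1..n}" "i \<le> n"
  shows "des (Suc n) (insert_max n i \<sigma>) = des n \<sigma> + of_bool (i \<notin> level_gaps n \<sigma>)"
  using card_split_gap[of "level_gaps n \<sigma>" i] finite_subset[OF level_gaps_subset]
  by (simp add: card_level_gaps flip: level_gaps_insert_max[OF assms])

lemma monom_insert_max: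
  assumes "\<epsilon> * \<epsilon> = 1" "\<sigma> permutes {1..n}" "i \<le> n"
  shows "monom (parity_weight \<epsilon> (insert_max n i \<sigma>)) (des (Suc n) (insert_max n i \<sigma>))
    = [:\<epsilon>:] ^ (n + i) * insertion_weight [:0, 1:] (level_gaps n \<sigma>) i
      * monom (parity_weight \<epsilon> \<sigma>) (des n \<sigma>)"
  using assms
  by (simp add: parity_weight_insert_max des_insert_max insertion_weight_def poly_const_pow
      smult_monom monom_Suc)

lemma sum_insertion_weight_level_gaps:
  "(\<Sum>i\<le>n. insertion_weight [:0, 1:] (level_gaps n \<sigma>) i) * monom c (des n \<sigma>)
    = monom c (des n \<sigma>) + eulerian_op n (monom c (des n \<sigma>))"
  by (simp add: sum_insertion_weight[OF _ level_gaps_subset] card_level_gaps eulerian_op_monom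
      algebra_simps)

lemma stat_poly_des_1: "stat_poly 1 n (des n) = eulerian_poly n"
proof (induction n)
  case 0
  show ?case by (simp add: stat_poly_0 des_def)
next
  case (Suc n)
  define F where "F m \<pi> = monom (parity_weight 1 \<pi>) (des m \<pi>)" for m \<pi>
  have "stat_poly 1 (Suc n) (des (Suc n))
      = (\<Sum>\<sigma> | \<sigma> permutes {1..n}. \<Sum>i\<le>n. F (Suc n) (insert_max n i \<sigma>))"
    by (simp only: stat_poly_def F_def sum_permutes_insert_max)
  also have "\<dots> = (\<Sum>\<sigma> | \<sigma> permutes {1..n}.
      (\<Sum>i\<le>n. insertion_weight [:0, 1:] (level_gaps n \<sigma>) i) * F n \<sigma>)"
    unfolding sum_distrib_right F_def
    by (intro sum.cong refl) (simp add: monom_insert_max flip: one_pCons)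
  also have "\<dots> = stat_poly 1 n (des n) + eulerian_op n (stat_poly 1 n (des n))"
    by (simp only: sum_insertion_weight_level_gaps F_def stat_poly_def eulerian_op_sum
        sum.distrib)
  finally show ?case by (simp add: Suc.IH)
qed

lemma alternating_sum_insertion_weight_split_gap:
  fixes t :: "'a :: comm_ring_1" and N :: "nat set"
  assumes "i \<le> n"
  defines "h \<equiv> \<lambda>j. (-1) ^ j * insertion_weight t N j"
  shows "(\<Sum>j\<le>Suc n. (-1) ^ j * insertion_weight t (split_gap i N) j)
    = (\<Sum>j<i. h j) - (\<Sum>j | j \<le> n \<and> i < j. h j) - (-1) ^ i * (1 - t)"
proof -
  define g where "g j = (-1) ^ j * insertion_weight t (split_gap i N) j" for j
  have before: "j \<in> split_gap i N \<longleftrightarrow> j \<in> N" if "j < i" for j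
    using that by (auto simp: split_gap_def)
  have after: "Suc j \<in> split_gap i N \<longleftrightarrow> j \<in> N" if "i < j" for j
    using that by (auto simp: split_gap_def)
  have at_gap: "i \<notin> split_gap i N" "Suc i \<in> split_gap i N"
    by (auto simp: split_gap_def)
  have "{..Suc n} = {..<i} \<union> ({i, Suc i} \<union> Suc ` {j. j \<le> n \<and> i < j})"
  proof (rule set_eqI)
    fix q
    show "q \<in> {..Suc n} \<longleftrightarrow> q \<in> {..<i} \<union> ({i, Suc i} \<union> Suc ` {j. j \<le> n \<and> i < j})"
      using assms(1) by (cases q) (auto simp: image_iff)
  qed
  then have "sum g {..Suc n} = sum g {..<i} + sum g ({i, Suc i} \<union> Suc ` {j. j \<le> n \<and> i < j})"
    by (simp only:) (rule sum.union_disjoint; auto)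
  also have "sum g ({i, Suc i} \<union> Suc ` {j. j \<le> n \<and> i < j})
      = g i + g (Suc i) + sum g (Suc ` {j. j \<le> n \<and> i < j})"
    by (subst sum.union_disjoint) auto
  also have "sum g (Suc ` {j. j \<le> n \<and> i < j}) = - (\<Sum>j | j \<le> n \<and> i < j. h j)"
    by (simp add: sum.reindex g_def h_def insertion_weight_def after sum_negf[symmetric])
  also have "sum g {..<i} = (\<Sum>j<i. h j)"
    by (simp add: g_def h_def insertion_weight_def before)
  finally show ?thesis
    by (simp add: g_def insertion_weight_def at_gap algebra_simps)
qed

lemma signed_insertion_weight_times_alternating_sum:
  fixes t :: "'a :: comm_ring_1" and N :: "nat set"
  assumes "i \<le> n"
  defines "h \<equiv> \<lambda>j. (-1) ^ j * insertion_weight t N j"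
  shows "(-1) ^ (n + i) * insertion_weight t N i
      * (\<Sum>j\<le>Suc n. (-1) ^ (Suc n + j) * insertion_weight t (split_gap i N) j)
    = (\<Sum>j | j \<le> n \<and> i < j. h i * h j) - (\<Sum>j | j \<le> n \<and> j < i. h i * h j)
      + (1 - t) * insertion_weight t N i"
proof -
  define s where "s = (\<Sum>j\<le>Suc n. (-1) ^ j * insertion_weight t (split_gap i N) j)"
  have "(\<Sum>j\<le>Suc n. (-1) ^ (Suc n + j) * insertion_weight t (split_gap i N) j)
      = - ((-1) ^ n * s)"
    unfolding s_def sum_distrib_left sum_negf[symmetric]
    by (intro sum.cong) (simp_all add: power_add mult.assoc)
  then have "(-1) ^ (n + i) * insertion_weight t N i
      * (\<Sum>j\<le>Suc n. (-1) ^ (Suc n + j) * insertion_weight t (split_gap i N) j) = - (h i * s)"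
    by (simp add: h_def power_add mult.assoc mult.left_commute)
  also have "{..<i} = {j. j \<le> n \<and> j < i}"
    using assms(1) by auto
  then have "s = (\<Sum>j | j \<le> n \<and> j < i. h j) - (\<Sum>j | j \<le> n \<and> i < j. h j) - (-1) ^ i * (1 - t)"
    unfolding s_def h_def alternating_sum_insertion_weight_split_gap[OF assms(1)] by simp
  also have "- (h i * ((\<Sum>j | j \<le> n \<and> j < i. h j) - (\<Sum>j | j \<le> n \<and> i < j. h j)
        - (-1) ^ i * (1 - t)))
      = h i * (\<Sum>j | j \<le> n \<and> i < j. h j) - h i * (\<Sum>j | j \<le> n \<and> j < i. h j)
        + (1 - t) * (h i * (-1) ^ i)"
    by (simp add: algebra_simps)
  also have "h i * (-1) ^ i = insertion_weight t N i"
    by (simp add: h_def mult.assoc mult.left_commute[of _ "insertion_weight t N i"])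
  finally show ?thesis
    by (simp only: sum_distrib_left)
qed

text \<open>A pair of nonadjacent insertions cancels with the one that exchanges the two letters; what
  survives is the term in which the second letter is put directly before or after the first.\<close>

lemma alternating_sum_insertion_weight_twice:
  fixes t :: "'a :: comm_ring_1"
  shows "(\<Sum>i\<le>n. (-1) ^ (n + i) * insertion_weight t N i
      * (\<Sum>j\<le>Suc n. (-1) ^ (Suc n + j) * insertion_weight t (split_gap i N) j))
    = (1 - t) * (\<Sum>i\<le>n. insertion_weight t N i)"
proof -
  define h where "h j = (-1) ^ j * insertion_weight t N j" for j
  have "(\<Sum>i\<le>n. (-1) ^ (n + i) * insertion_weight t N i
      * (\<Sum>j\<le>Suc n. (-1) ^ (Suc n + j) * insertion_weight t (split_gap i N) j))
    = (\<Sum>i\<le>n. (\<Sum>j | j \<le> n \<and> i < j. h i * h j) - (\<Sum>j | j \<le> n \<and> j < i. h i * h j)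
        + (1 - t) * insertion_weight t N i)"
    unfolding h_def
    by (intro sum.cong refl signed_insertion_weight_times_alternating_sum) simp
  also have "\<dots> = (\<Sum>i\<le>n. \<Sum>j | j \<le> n \<and> i < j. h i * h j)
      - (\<Sum>i\<le>n. \<Sum>j | j \<le> n \<and> j < i. h i * h j) + (1 - t) * (\<Sum>i\<le>n. insertion_weight t N i)"
    by (simp only: sum.distrib sum_subtractf sum_distrib_left)
  also have "(\<Sum>i\<le>n. \<Sum>j | j \<le> n \<and> i < j. h i * h j)
      = (\<Sum>i\<le>n. \<Sum>j | j \<le> n \<and> j < i. h i * h j)"
    using sum.swap_restrict[of "{..n}" "{..n}" "\<lambda>i j. h i * h j" "(<)"]
    by (simp add: mult.commute)
  finally show ?thesis by simp
qed

lemma stat_poly_des_minus_1_Suc_Suc: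
  "stat_poly (-1) (Suc (Suc n)) (des (Suc (Suc n)))
    = [:1, -1:] * (stat_poly (-1) n (des n) + eulerian_op n (stat_poly (-1) n (des n)))"
proof -
  define F where "F m \<pi> = monom (parity_weight (-1) \<pi>) (des m \<pi>)" for m \<pi>
  define w where "w \<sigma> i = insertion_weight [:0, 1 :: real:] (level_gaps n \<sigma>) i" for \<sigma> i
  define w' where "w' \<sigma> i j = insertion_weight [:0, 1 :: real:] (split_gap i (level_gaps n \<sigma>)) j"
    for \<sigma> i j
  have const_minus_1: "[:-1:] = (-1 :: real poly)"
    by (simp add: one_pCons)
  have one_step: "F (Suc m) (insert_max m i \<sigma>)
      = (-1) ^ (m + i) * insertion_weight [:0, 1:] (level_gaps m \<sigma>) i * F m \<sigma>"
    if "\<sigma> permutes {1..m}" "i \<le> m" for m i \<sigma>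
    unfolding F_def using monom_insert_max[of "-1", OF _ that] by (simp add: const_minus_1)
  have two_steps: "F (Suc (Suc n)) (insert_max (Suc n) j (insert_max n i \<sigma>))
      = (-1) ^ (n + i) * w \<sigma> i * ((-1) ^ (Suc n + j) * w' \<sigma> i j) * F n \<sigma>"
    if "\<sigma> permutes {1..n}" "i \<le> n" "j \<le> Suc n" for \<sigma> i j
    by (simp only: one_step[OF insert_max_permutes[OF that(2,1)] that(3)] one_step[OF that(1,2)]
        level_gaps_insert_max[OF that(1,2)] w_def w'_def mult_ac)
  have "stat_poly (-1) (Suc (Suc n)) (des (Suc (Suc n)))
      = (\<Sum>\<sigma> | \<sigma> permutes {1..n}. \<Sum>i\<le>n. \<Sum>j\<le>Suc n.
          F (Suc (Suc n)) (insert_max (Suc n) j (insert_max n i \<sigma>)))"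
    by (simp only: stat_poly_def F_def sum_permutes_insert_max)
  also have "\<dots> = (\<Sum>\<sigma> | \<sigma> permutes {1..n}.
      (\<Sum>i\<le>n. (-1) ^ (n + i) * w \<sigma> i * (\<Sum>j\<le>Suc n. (-1) ^ (Suc n + j) * w' \<sigma> i j)) * F n \<sigma>)"
    unfolding sum_distrib_right sum_distrib_left
    by (intro sum.cong refl two_steps) auto
  also have "\<dots> = (\<Sum>\<sigma> | \<sigma> permutes {1..n}. (1 - [:0, 1:]) * ((\<Sum>i\<le>n. w \<sigma> i) * F n \<sigma>))"
    unfolding w_def w'_def alternating_sum_insertion_weight_twice by (simp only: mult.assoc)
  also have "\<dots> = (1 - [:0, 1:])
      * (stat_poly (-1) n (des n) + eulerian_op n (stat_poly (-1) n (des n)))"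
    by (simp only: w_def sum_insertion_weight_level_gaps F_def stat_poly_def eulerian_op_sum
        sum.distrib flip: sum_distrib_left)
  finally show ?thesis
    by (simp add: one_pCons)
qed

lemma stat_poly_des_minus_1:
  "stat_poly (-1) n (des n) = [:1, -1:] ^ (n div 2) * eulerian_poly (Suc n div 2)"
proof (induction n rule: induct_nat_012)
  case 0
  show ?case by (simp add: stat_poly_0 des_def)
next
  case 1
  show ?case
    by (simp add: stat_poly_def parity_weight_def des_def eulerian_op_def)
next
  case (ge2 n)
  have "n = n div 2 + Suc n div 2" by linarith
  then have "eulerian_op n ([:1, -1:] ^ (n div 2) * eulerian_poly (Suc n div 2))
      = [:1, -1:] ^ (n div 2) * eulerian_op (Suc n div 2) (eulerian_poly (Suc n div 2))"
    using eulerian_op_power_mult[of "n div 2" "Suc n div 2"] by simp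
  then show ?case
    by (simp only: stat_poly_des_minus_1_Suc_Suc ge2.IH) (simp add: algebra_simps)
qed

lemma less_two_power_half:
  assumes "5 \<le> n"
  shows "n < 2 ^ (Suc n div 2)"
proof -
  have "2 * m < (2 :: nat) ^ m" if "3 \<le> m" for m
    using that by (induction m rule: nat_induct_at_least) auto
  then have "2 * (Suc n div 2) < 2 ^ (Suc n div 2)"
    using assms by simp
  then show ?thesis by linarith
qed

theorem corollary8:
  fixes n :: nat
  assumes "n \<ge> 5"
  shows "ultra_log_concave (n - 1) (\<lambda>k. real (B_num n k)) \<and>
         ultra_log_concave (n - 1) (\<lambda>k. real (C_num n k)) \<and>
         ultra_log_concave (n - 1) (\<lambda>k. real (P_num n k)) \<and>
         ultra_log_concave (n - 1) (\<lambda>k. real (Q_num n k))"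
proof -
  have des_indices: "n = n div 2 + Suc n div 2" "1 \<le> Suc n div 2" "Suc n div 2 \<le> Suc (n div 2)"
    "Suc n div 2 = 1 \<or> n < 2 ^ (Suc n div 2)"
    using assms less_two_power_half by auto
  have exc_indices: "n = (n - 1) + 1" "1 \<le> (1::nat)" "1 \<le> Suc (n - 1)" "1 = (1::nat) \<or> n < 2 ^ 1"
    using assms by auto
  have "stat_poly (-1) n (exc n) = [:1, -1:] ^ (n - 1) * eulerian_poly 1"
    using stat_poly_exc_minus_1[of "n - 1"] assms by (simp add: eulerian_op_def)
  note exc = ultra_log_concave_parity_counts[OF assms exc_indices stat_poly_exc_1 this]
  note des = ultra_log_concave_parity_counts[OF assms des_indices stat_poly_des_1
      stat_poly_des_minus_1]
  show ?thesis
    unfolding B_num_def C_num_def P_num_def Q_num_def by (intro conjI des exc)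
qed

end
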